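(* Let $b \geq 3$ be an integer and $D \subset \{0,1,\ldots,b-1\}$ with $2 \leq \#D \leq b-1$; let $C(b,D)$ be the corresponding generalized Cantor set with Hausdorff dimension $\gamma = \log\#D/\log b$, and let $m$ be the greatest integer such that $D \subset \{m, m+1, \ldots, b-1-m\}$. Let $t \geq 2$ be an integer having the same set of prime divisors as $b$, and let $A=(a_{n})_{n \geq 1}$ be an unbounded non-decreasing sequence of positive integers. Let $f$ be a dimension function such that $r\mapsto r^{-\gamma} f(r)$ is monotonic, and let $\psi : \mathbb{N} \to (0,\infty)$ be any function. Then: (i) if $\displaystyle\sum_{i \in I \colon \psi_{A}(i) > \frac{m}{(b-1) b^{\lceil i \alpha_{2} \rceil }}} f\left(\psi_{A}(i) - \frac{m}{(b-1) b^{\lceil i \alpha_{2} \rceil }}\right) b^{i \alpha_{2} \gamma } < \infty$, then $\mathcal{H}^{f} (W_{t,A}(\psi) \cap C(b,D)) = 0$; (ii) if $\displaystyle\sum_{i \in I \colon \psi_{A}(i) > \frac{m}{(b-1) b^{\lfloor i \alpha_{1} \rfloor }}} f\left(\psi_{A}(i) - \frac{m}{(b-1) b^{\lfloor i \alpha_{1} \rfloor }}\right) b^{i \alpha_{1} \gamma} = \infty$, then $\mathcal{H}^{f} (W_{t,A}(\psi) \cap C(b,D)) = \mathcal{H}^{f}(C(b,D))$.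
   Context: The generalized Cantor set $C(b,D)$ is the set of real numbers $x \in [0,1]$ whose base-$b$ expansion uses only digits from $D$. A dimension function is a continuous, non-decreasing function $f:(0,\infty)\to(0,\infty)$ with $\lim_{r\to 0} f(r)=0$; $\mathcal{H}^f$ is the Hausdorff $f$-measure. For a sequence $A=(a_n)_{n\ge1}$ of positive integers, $W_{t,A}(\psi) = \{x \in [0,1] : |x - p/t^{a_n}| < \psi(n) \text{ for infinitely many } (p,n) \in \mathbb{N}^2\}$; $I = I(A) = \{i \in \mathbb{N} : a_n = i \text{ for some } n\}$; for $i \in I$, $\psi_A(i) = \max\{\psi(n) : a_n = i\}$. For a prime $q$, $v_q(x)$ is the exponent of $q$ in $x$, and $\alpha_1 = \min\{v_q(t)/v_q(b) : q \text{ a prime divisor of } b\}$, $\alpha_2 = \max\{v_q(t)/v_q(b) : q \text{ a prime divisor of } b\}$. $\lfloor\cdot\rfloor$, $\lceil\cdot\rceil$ are the floor and ceiling functions. *)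

theory Defs
  imports "HOL-Analysis.Analysis" "HOL-Computational_Algebra.Primes"
begin

definition cantor_set :: "nat \<Rightarrow> nat set \<Rightarrow> real set" where
  "cantor_set b D = {x. 0 \<le> x \<and> x \<le> 1 \<and>
     (\<exists>d :: nat \<Rightarrow> nat. (\<forall>k. d k \<in> D) \<and>
        (\<lambda>k. real (d k) / real b ^ (Suc k)) sums x)}"

definition dimension_function :: "(real \<Rightarrow> real) \<Rightarrow> bool" where
  "dimension_function f \<longleftrightarrow> continuous_on {0<..} f \<and> mono_on {0<..} f \<and>
     (\<forall>r>0. f r > 0) \<and> (f \<longlongrightarrow> 0) (at_right 0)"

text \<open>Hausdorff f-measure (with the usual convention f(0) = 0 for sets of diameter 0).\<close>
definition hausdorff_pre :: "(real \<Rightarrow> real) \<Rightarrow> real \<Rightarrow> real set \<Rightarrow> ennreal" where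
  "hausdorff_pre f \<delta> E = (INF U \<in> {U :: nat \<Rightarrow> real set. E \<subseteq> (\<Union>i. U i) \<and>
        (\<forall>i. bounded (U i) \<and> diameter (U i) \<le> \<delta>)}.
      (\<Sum>i. ennreal (if diameter (U i) > 0 then f (diameter (U i)) else 0)))"

definition hausdorff_measure :: "(real \<Rightarrow> real) \<Rightarrow> real set \<Rightarrow> ennreal" where
  "hausdorff_measure f E = (SUP \<delta> \<in> {0<..}. hausdorff_pre f \<delta> E)"

definition W_set :: "nat \<Rightarrow> (nat \<Rightarrow> nat) \<Rightarrow> (nat \<Rightarrow> real) \<Rightarrow> real set" where
  "W_set t a \<psi> = {x. 0 \<le> x \<and> x \<le> 1 \<and>
     infinite {(p, n). n \<ge> 1 \<and> \<bar>x - real p / real t ^ a n\<bar> < \<psi> n}}"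

definition I_set :: "(nat \<Rightarrow> nat) \<Rightarrow> nat set" where
  "I_set a = {i. \<exists>n\<ge>1. a n = i}"

definition psiA :: "(nat \<Rightarrow> nat) \<Rightarrow> (nat \<Rightarrow> real) \<Rightarrow> nat \<Rightarrow> real" where
  "psiA a \<psi> i = Max {\<psi> n | n. n \<ge> 1 \<and> a n = i}"

definition alpha1 :: "nat \<Rightarrow> nat \<Rightarrow> real" where
  "alpha1 b t = Min ((\<lambda>q. real (multiplicity q t) / real (multiplicity q b)) ` prime_factors b)"

definition alpha2 :: "nat \<Rightarrow> nat \<Rightarrow> real" where
  "alpha2 b t = Max ((\<lambda>q. real (multiplicity q t) / real (multiplicity q b)) ` prime_factors b)"

definition m_of :: "nat \<Rightarrow> nat set \<Rightarrow> nat" where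
  "m_of b D = (GREATEST m. D \<subseteq> {m..b-1-m})"

end

(* Part (i): t^i divides b^k for k = ceiling (i alpha_2), so every fraction p/t^i is a level-k grid point.  Near such
   a grid point the Cantor set only meets the two adjacent level-k cylinders, each in an interval of
   length rho = psi_A(i) - m/((b-1) b^k).  This gives a cover by 2 (#D)^k intervals of length rho.

   Part (ii): b^k divides t^i for k = floor (i alpha_1), and m or b-1-m is a digit c in D.  So it is enough that the
   digits k, ..., k+l-1 of x all equal c, where b^-(k+l) < rho.  Counting only runs preceded by a digit
   other than c makes any two of these events disjoint or independent.  Write q = #D and
   f(b^-n) = F(n) q^-n; monotonicity of r^-gamma f(r) leaves two cases.
   If F is bounded, an exact Borel-Cantelli count of words without such runs shows that the points of the
   Cantor set outside W form an H^f-null set.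
   If F increases to infinity, both measures are infinite.  Given a countable cover by cylinders of small
   total weight, a greedy descent finds a point with infinitely many runs outside the cover: it passes from
   a word w to an antichain of longer words ending in runs, and double counting shows that some word
   in it again carries little of the cover.  This replaces the mass transference principle. *)
theory Submission
  imports Defs "HOL-Library.Sublist"
begin

section \<open>Hausdorff pre-measures\<close>

text \<open>When F is unbounded, the sum of q^-l over the available levels may converge; then almost
  every digit sequence has only finitely many runs, and no count of typical words can reach the
  limit set. The point has to be steered. With \<phi>(n) = f(b^-n), the descent keeps the cover
  words at or below the current word w lighter than \<phi>(|w|) / 8 and no cover word a strict
  prefix of w. Two demands on the levels of one step compete: the sum of q^-l must stay at most 1/4,
  so that early runs leave room for later ones, yet the sum of F(k + l) q^-l must reach 9 F(|w|), so
  that the new words outweigh what the cover can spoil. That F tends to infinity reconciles them.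
  The outcome is a lower bound F(n) / (48 q) for the pre-measure at scale b^-n, for every n: a
  covering set meets at most 3 cylinders of its level, rounding its diameter to a power of 1/b costs
  a factor q, and 3 q / (48 q) = 1/16 leaves room below 1/8. In the bounded case the exceptional set
  is null for each pre-measure, so subadditivity suffices and measurability never enters.\<close>

lemma hausdorff_pre_mono: "X \<subseteq> Y \<Longrightarrow> hausdorff_pre f \<delta> X \<le> hausdorff_pre f \<delta> Y"
  unfolding hausdorff_pre_def by (intro INF_superset_mono) auto

lemma hausdorff_measure_mono: "X \<subseteq> Y \<Longrightarrow> hausdorff_measure f X \<le> hausdorff_measure f Y"
  unfolding hausdorff_measure_def by (intro SUP_mono) (auto intro: hausdorff_pre_mono)

lemma hausdorff_pre_le_cover:
  assumes "X \<subseteq> (\<Union>i. U i)" "\<And>i. bounded (U i)" "\<And>i. diameter (U i) \<le> \<delta>"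
  shows "hausdorff_pre f \<delta> X \<le>
    (\<Sum>i::nat. ennreal (if diameter (U i) > 0 then f (diameter (U i)) else 0))"
  unfolding hausdorff_pre_def using assms by (intro INF_lower) auto

lemma hausdorff_pre_empty: "\<delta> \<ge> 0 \<Longrightarrow> hausdorff_pre f \<delta> {} = 0"
  using hausdorff_pre_le_cover[of "{}" "\<lambda>_. {}" \<delta> f] by simp

text \<open>Covers that are optimal up to e / 2^(n+1) are merged along the pairing bijection.
  Besides monotonicity and explicit covers, this is all that the upper bounds below use of the
  pre-measures.\<close>

lemma hausdorff_pre_UN:
  fixes X :: "nat \<Rightarrow> real set"
  shows "hausdorff_pre f \<delta> (\<Union>n. X n) \<le> (\<Sum>n. hausdorff_pre f \<delta> (X n))"
proof (rule ennreal_le_epsilon)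
  fix e :: real
  assume fin: "(\<Sum>n. hausdorff_pre f \<delta> (X n)) < top" and e: "0 < e"
  define w where "w \<equiv> \<lambda>U :: real set. ennreal (if diameter U > 0 then f (diameter U) else 0)"
  have "\<exists>U. X n \<subseteq> (\<Union>i. U i) \<and> (\<forall>i. bounded (U i) \<and> diameter (U i) \<le> \<delta>) \<and>
      (\<Sum>i::nat. w (U i)) \<le> hausdorff_pre f \<delta> (X n) + ennreal (e * (1/2) ^ Suc n)" for n
  proof -
    have "hausdorff_pre f \<delta> (X n) \<noteq> top"
      using fin by (metis ennreal_suminf_lessD less_irrefl)
    define h where "h = hausdorff_pre f \<delta> (X n) + ennreal (e * (1/2) ^ Suc n)"
    obtain r where r: "hausdorff_pre f \<delta> (X n) = ennreal r" "0 \<le> r"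
      using \<open>hausdorff_pre f \<delta> (X n) \<noteq> top\<close>
      by (cases "hausdorff_pre f \<delta> (X n)") auto
    have "ennreal r < ennreal (r + e * (1/2) ^ Suc n)"
      using e r(2) by (intro ennreal_lessI) (auto intro!: add_nonneg_pos)
    also have "\<dots> = h"
      unfolding h_def r(1) using e r(2) by (intro ennreal_plus) auto
    finally have "hausdorff_pre f \<delta> (X n) < h" using r(1) by simp
    then obtain V where V: "V \<in> {U. X n \<subseteq> (\<Union>i. U i) \<and> (\<forall>i. bounded (U i) \<and> diameter (U i) \<le> \<delta>)}"
        "(\<Sum>i::nat. w (V i)) < h"
      unfolding hausdorff_pre_def INF_less_iff w_def by (rule bexE)
    then have "\<exists>U. X n \<subseteq> (\<Union>i. U i) \<and> (\<forall>i. bounded (U i) \<and> diameter (U i) \<le> \<delta>) \<and>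
        (\<Sum>i::nat. w (U i)) \<le> h"
      by (intro exI[of _ V]) (simp add: less_imp_le)
    then show ?thesis unfolding h_def .
  qed
  then obtain U where U: "\<And>n. X n \<subseteq> (\<Union>i. U n i)" "\<And>n i. bounded (U n i)"
      "\<And>n i. diameter (U n i) \<le> \<delta>"
      "\<And>n. (\<Sum>i::nat. w (U n i)) \<le> hausdorff_pre f \<delta> (X n) + ennreal (e * (1/2) ^ Suc n)"
    by metis
  have "hausdorff_pre f \<delta> (\<Union>n. X n) \<le> (\<Sum>k. w (case prod_decode k of (n, i) \<Rightarrow> U n i))"
    unfolding w_def
  proof (rule hausdorff_pre_le_cover)
    show "(\<Union>n. X n) \<subseteq> (\<Union>k. case prod_decode k of (n, i) \<Rightarrow> U n i)"
    proof
      fix x assume "x \<in> (\<Union>n. X n)"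
      then obtain n i where "x \<in> U n i" using U(1) by blast
      then have "x \<in> (case prod_decode (prod_encode (n, i)) of (n, i) \<Rightarrow> U n i)" by simp
      then show "x \<in> (\<Union>k. case prod_decode k of (n, i) \<Rightarrow> U n i)" by (intro UN_I[of "prod_encode (n, i)"]) auto
    qed
  qed (auto split: prod.split simp: U)
  also have "\<dots> = (\<Sum>k. case_prod (\<lambda>n i. w (U n i)) (prod_decode k))"
    by (intro suminf_cong) (auto split: prod.split)
  also have "\<dots> = (\<Sum>n. \<Sum>i. w (U n i))"
    by (subst suminf_ennreal_2dimen) auto
  also have "\<dots> \<le> (\<Sum>n. hausdorff_pre f \<delta> (X n) + ennreal (e * (1/2) ^ Suc n))"
    by (intro suminf_le U(4)) auto
  also have "\<dots> = (\<Sum>n. hausdorff_pre f \<delta> (X n)) + (\<Sum>n. ennreal (e * (1/2) ^ Suc n))"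
    by (intro suminf_add[symmetric]) auto
  also have "(\<Sum>n. ennreal (e * (1/2) ^ Suc n)) = ennreal e"
  proof (rule suminf_ennreal_eq)
    show "(\<lambda>n. e * (1 / 2) ^ Suc n) sums e"
      using sums_mult[OF power_half_series, of e] by simp
  qed (use e in auto)
  finally show "hausdorff_pre f \<delta> (\<Union>n. X n) \<le> (\<Sum>n. hausdorff_pre f \<delta> (X n)) + ennreal e" .
qed

lemma hausdorff_pre_Un:
  assumes "\<delta> \<ge> 0"
  shows "hausdorff_pre f \<delta> (X \<union> Y) \<le> hausdorff_pre f \<delta> X + hausdorff_pre f \<delta> Y"
proof -
  define Z where "Z \<equiv> \<lambda>n::nat. if n = 0 then X else if n = 1 then Y else {}"
  have "X \<union> Y = (\<Union>n. Z n)"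
    unfolding Z_def by (auto split: if_splits intro: exI[of _ 0] exI[of _ 1])
  then have "hausdorff_pre f \<delta> (X \<union> Y) \<le> (\<Sum>n. hausdorff_pre f \<delta> (Z n))"
    using hausdorff_pre_UN by simp
  also have "\<dots> = (\<Sum>n\<in>{0,1}. hausdorff_pre f \<delta> (Z n))"
    by (intro suminf_finite) (auto simp: Z_def hausdorff_pre_empty assms)
  finally show ?thesis by (simp add: Z_def)
qed

text \<open>Splitting off one set at a time by subadditivity avoids an enumeration of
  \<open>J\<close>. Charging r instead of the true diameter is allowed because f is
  nondecreasing.\<close>

lemma hausdorff_pre_finite_cover:
  assumes f: "dimension_function f" and "finite J" and "X \<subseteq> (\<Union>j\<in>J. U j)"
    and "\<And>j. j \<in> J \<Longrightarrow> bounded (U j)" "\<And>j. j \<in> J \<Longrightarrow> diameter (U j) \<le> r"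
    and r: "0 < r" "r \<le> \<delta>"
  shows "hausdorff_pre f \<delta> X \<le> of_nat (card J) * ennreal (f r)"
  using assms(2-5)
proof (induction J arbitrary: X rule: finite_induct)
  case empty
  then show ?case using r by (simp add: hausdorff_pre_empty)
next
  case (insert j J)
  \<comment> \<open>The single set is padded to a sequence by empty sets, whose diameter 0 has
    weight 0 by convention.\<close>
  have "hausdorff_pre f \<delta> (U j) \<le> (\<Sum>i. ennreal (if diameter (if i = 0 then U j else {}) > 0
      then f (diameter (if i = (0::nat) then U j else {})) else 0))"
    using insert.prems r by (intro hausdorff_pre_le_cover) (auto intro: order_trans)
  also have "\<dots> = (\<Sum>i\<in>{0}. ennreal (if diameter (if i = 0 then U j else {}) > 0
      then f (diameter (if i = (0::nat) then U j else {})) else 0))"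
    by (intro suminf_finite) auto
  also have "\<dots> \<le> ennreal (f r)"
  proof -
    have "mono_on {0<..} f" "f r > 0" using f r by (auto simp: dimension_function_def)
    then show ?thesis using insert.prems r
      by (auto intro!: ennreal_leI mono_onD[of "{0<..}" f])
  qed
  finally have 1: "hausdorff_pre f \<delta> (U j) \<le> ennreal (f r)" .
  have "hausdorff_pre f \<delta> X \<le> hausdorff_pre f \<delta> (U j \<union> (X - U j))"
    by (rule hausdorff_pre_mono) auto
  also have "\<dots> \<le> hausdorff_pre f \<delta> (U j) + hausdorff_pre f \<delta> (X - U j)"
    using r by (intro hausdorff_pre_Un) auto
  also have "\<dots> \<le> ennreal (f r) + of_nat (card J) * ennreal (f r)"
    using insert.prems insert.IH[of "X - U j"] 1 by (intro add_mono) auto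
  finally show ?case using insert.hyps by (simp add: distrib_right)
qed

section \<open>Words and runs\<close>

definition words :: "nat set \<Rightarrow> nat \<Rightarrow> nat list set" where
  "words D n = {x. length x = n \<and> set x \<subseteq> D}"

text \<open>The condition on the digit before the block makes runs at overlapping positions mutually exclusive.\<close>
definition run :: "nat \<Rightarrow> (nat \<Rightarrow> nat) \<Rightarrow> nat \<Rightarrow> nat list \<Rightarrow> bool" where
  "run c l k x \<longleftrightarrow> 1 \<le> k \<and> k + l k \<le> length x \<and> x ! (k - 1) \<noteq> c \<and> (\<forall>i\<in>{k..<k + l k}. x ! i = c)"

lemma finite_words: "finite D \<Longrightarrow> finite (words D n)"
  unfolding words_def using finite_lists_length_eq[of D n] by (auto simp: conj_commute)

lemma card_words: "finite D \<Longrightarrow> card (words D n) = card D ^ n"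
  unfolding words_def using card_lists_length_eq[of D n] by (auto simp: conj_commute)

lemma words_append: "x \<in> words D i \<Longrightarrow> y \<in> words D j \<Longrightarrow> x @ y \<in> words D (i + j)"
  by (auto simp: words_def)

lemma words_append_iff:
  "length x = i \<Longrightarrow> x @ y \<in> words D (i + j) \<longleftrightarrow> x \<in> words D i \<and> y \<in> words D j"
  by (auto simp: words_def)

lemma take_words: "x \<in> words D n \<Longrightarrow> i \<le> n \<Longrightarrow> take i x \<in> words D i"
  by (auto simp: words_def dest: in_set_takeD)

lemma drop_words: "x \<in> words D n \<Longrightarrow> drop i x \<in> words D (n - i)"
  by (auto simp: words_def dest: in_set_dropD)

lemma replicate_words: "c \<in> D \<Longrightarrow> replicate n c \<in> words D n"
  by (auto simp: words_def)

lemma run_append: "k + l k \<le> length x \<Longrightarrow> run c l k (x @ y) \<longleftrightarrow> run c l k x"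
  by (auto simp: run_def nth_append)

lemma run_prefix: "run c l k x \<Longrightarrow> prefix x y \<Longrightarrow> run c l k y"
  by (elim prefixE) (simp add: run_append run_def[of c l k x, THEN iffD1, THEN conjunct2, THEN conjunct1])

lemma run_take: "k + l k \<le> n \<Longrightarrow> n \<le> length x \<Longrightarrow> run c l k (take n x) \<longleftrightarrow> run c l k x"
  by (auto simp: run_def)

text \<open>Position k - 1 comes at or after j, so a block reaching past it would give it the digit
  c. Hence, once a run may start at k, every run at an earlier j is decided by the first k - 1
  digits alone; this is the independence behind both counting arguments.\<close>

lemma run_disjoint:
  assumes "run c l j x" "x ! (k - 1) \<noteq> c" "j < k"
  shows "j + l j < k"
proof (rule ccontr)
  assume "\<not> j + l j < k"
  then have "k - 1 \<in> {j..<j + l j}" using assms(3) by auto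
  then show False using assms by (auto simp: run_def)
qed

lemma card_extensions:
  assumes "finite D" "w \<in> words D n" "n \<le> k"
  shows "card {y \<in> words D k. prefix w y} = card D ^ (k - n)"
proof -
  have "{y \<in> words D k. prefix w y} = (\<lambda>z. w @ z) ` words D (k - n)"
  proof (intro set_eqI iffI)
    fix y assume "y \<in> {y \<in> words D k. prefix w y}"
    then obtain z where "y = w @ z" "w @ z \<in> words D (n + (k - n))"
      using assms by (auto simp: prefix_def)
    then show "y \<in> (\<lambda>z. w @ z) ` words D (k - n)"
      using assms(2) words_append_iff[of w n z D "k - n"] by (auto simp: words_def)
  next
    fix y assume "y \<in> (\<lambda>z. w @ z) ` words D (k - n)"
    then show "y \<in> {y \<in> words D k. prefix w y}"
      using assms words_append[OF assms(2), of _ "k - n"] by auto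
  qed
  then show ?thesis using assms by (simp add: card_image inj_on_def card_words)
qed

text \<open>The block positions are forced, which leaves k - n - l free digits. Used with l = 1 for
  the words that have the digit c just before k, and with \<open>l j\<close> for those containing an
  earlier block.\<close>

lemma card_extensions_constant_le:
  assumes D: "finite D" and w: "w \<in> words D n" and jk: "n \<le> j" "j + l \<le> k"
  shows "card {y \<in> words D k. prefix w y \<and> (\<forall>i\<in>{j..<j + l}. y ! i = c)} \<le> card D ^ (k - n - l)"
proof -
  let ?g = "\<lambda>(x, z). x @ replicate l c @ z"
  let ?P = "{y \<in> words D j. prefix w y} \<times> words D (k - j - l)"
  have fin: "finite ?P" using D finite_words by auto
  have "{y \<in> words D k. prefix w y \<and> (\<forall>i\<in>{j..<j + l}. y ! i = c)} \<subseteq> ?g ` ?P"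
  proof
    fix y assume "y \<in> {y \<in> words D k. prefix w y \<and> (\<forall>i\<in>{j..<j + l}. y ! i = c)}"
    then have y: "y \<in> words D k" "prefix w y" "\<And>i. i \<in> {j..<j + l} \<Longrightarrow> y ! i = c" by auto
    have len: "length y = k" "length w = n" using y w by (auto simp: words_def)
    have "take l (drop j y) = replicate l c"
      using y(3) len jk by (intro nth_equalityI) auto
    then have "y = take j y @ replicate l c @ drop (j + l) y"
      by (metis append_take_drop_id drop_drop add.commute)
    moreover have "take j y \<in> words D j" using y jk by (intro take_words) auto
    moreover have "prefix w (take j y)"
      using y(2) len jk by (auto simp: prefix_def)
    moreover have "drop (j + l) y \<in> words D (k - j - l)"
      using drop_words[OF y(1), of "j + l"] by simp
    ultimately show "y \<in> ?g ` ?P" by (intro image_eqI[of _ _ "(take j y, drop (j + l) y)"]) auto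
  qed
  then have "card {y \<in> words D k. prefix w y \<and> (\<forall>i\<in>{j..<j + l}. y ! i = c)} \<le> card (?g ` ?P)"
    using fin by (intro card_mono) auto
  also have "\<dots> \<le> card ?P" by (rule card_image_le[OF fin])
  also have "\<dots> = card D ^ (j - n) * card D ^ (k - j - l)"
    using assms by (simp add: card_cartesian_product card_extensions card_words)
  also have "\<dots> = card D ^ (k - n - l)"
    using jk by (simp add: power_add[symmetric])
  finally show ?thesis .
qed

text \<open>Everything depends on the first k - 1 digits. Cutting there injects \<open>A k\<close>
  into \<open>Bw\<close> times the free tails, while each word of \<open>Bw\<close>, followed by a
  digit other than c, the block and a free tail, lands in \<open>R\<close>. So the words with a run
  at k take at least the proportion (q - 1) / q^(l k + 1) of \<open>A k\<close>, whatever happened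
  at earlier levels.\<close>

lemma card_avoid_step:
  fixes D S c l L k
  defines "A \<equiv> \<lambda>k. {x \<in> words D L. \<forall>j\<in>S. j < k \<longrightarrow> \<not> run c l j x}"
  assumes D: "finite D" "c \<in> D" "2 \<le> card D"
    and S: "\<And>j. j \<in> S \<Longrightarrow> 1 \<le> j \<and> j + l j \<le> L" and k: "k \<in> S"
  shows "real (card (A (Suc k))) \<le> (1 - 1 / (2 * real (card D) ^ l k)) * real (card (A k))"
proof -
  define q where "q = card D"
  define Bw where "Bw = {u \<in> words D (k - 1). \<forall>j\<in>S. j + l j < k \<longrightarrow> \<not> run c l j u}"
  define R where "R = {x \<in> A k. run c l k x}"
  have kL: "1 \<le> k" "k + l k \<le> L" using S[OF k] by auto
  have finA: "finite (A k)" "finite Bw" "finite R" "finite (A (Suc k))"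
    using finite_words[OF D(1)] by (auto simp: A_def Bw_def R_def)
  have "card (A k) \<le> card (Bw \<times> words D (L - k + 1))"
  proof (rule card_inj_on_le)
    show "inj_on (\<lambda>x. (take (k - 1) x, drop (k - 1) x)) (A k)"
      by (intro inj_onI) (metis append_take_drop_id prod.inject)
    show "(\<lambda>x. (take (k - 1) x, drop (k - 1) x)) ` A k \<subseteq> Bw \<times> words D (L - k + 1)"
    proof
      fix z assume "z \<in> (\<lambda>x. (take (k - 1) x, drop (k - 1) x)) ` A k"
      then obtain x where x: "x \<in> A k" "z = (take (k - 1) x, drop (k - 1) x)" by auto
      have xL: "x \<in> words D L" "length x = L" using x by (auto simp: A_def words_def)
      have "drop (k - 1) x \<in> words D (L - k + 1)"
        using drop_words[OF xL(1), of "k - 1"] kL by (simp add: Suc_diff_le)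
      moreover have "\<not> run c l j (take (k - 1) x)" if "j \<in> S" "j + l j < k" for j
        using x(1) that kL xL by (subst run_take) (auto simp: A_def)
      moreover have "take (k - 1) x \<in> words D (k - 1)"
        using kL by (intro take_words[OF xL(1)]) auto
      ultimately show "z \<in> Bw \<times> words D (L - k + 1)" using x(2) by (auto simp: Bw_def)
    qed
  qed (use finA D finite_words in auto)
  then have 1: "card (A k) \<le> card Bw * q ^ (L - k + 1)"
    by (simp add: card_cartesian_product card_words D q_def)
  have "card (Bw \<times> ((D - {c}) \<times> words D (L - k - l k))) \<le> card R"
  proof (rule card_inj_on_le)
    let ?g = "\<lambda>(u, d, z). u @ d # replicate (l k) c @ z"
    show "inj_on ?g (Bw \<times> ((D - {c}) \<times> words D (L - k - l k)))"
      by (auto simp: inj_on_def Bw_def words_def)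
    show "?g ` (Bw \<times> ((D - {c}) \<times> words D (L - k - l k))) \<subseteq> R"
    proof
      fix x assume "x \<in> ?g ` (Bw \<times> ((D - {c}) \<times> words D (L - k - l k)))"
      then obtain u d z where x: "x = u @ d # replicate (l k) c @ z" "u \<in> Bw" "d \<in> D" "d \<noteq> c"
        "z \<in> words D (L - k - l k)" by auto
      have u: "length u = k - 1" "set u \<subseteq> D" using x by (auto simp: Bw_def words_def)
      have "length x = L" using x u kL by (auto simp: words_def)
      moreover have "set x \<subseteq> D" using x u D by (auto simp: words_def)
      ultimately have w: "x \<in> words D L" by (auto simp: words_def)
      have "x ! i = c" if "i \<in> {k..<k + l k}" for i
        using that x(1) u kL by (auto simp: nth_append nth_Cons')
      moreover have xk: "x ! (k - 1) \<noteq> c" using x u by (auto simp: nth_append)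
      ultimately have r: "run c l k x" using kL \<open>length x = L\<close> by (auto simp: run_def)
      \<comment> \<open>The digit d at position k - 1 confines a run at j < k to u, where membership
        in \<open>Bw\<close> forbids it.\<close>
      have "\<not> run c l j x" if j: "j \<in> S" "j < k" for j
      proof
        assume rj: "run c l j x"
        have jl: "j + l j < k" using run_disjoint[OF rj xk j(2)] .
        have "run c l j u"
          using rj run_append[of j l u c "d # replicate (l k) c @ z"] jl u x(1) by auto
        then show False using x(2) jl j by (auto simp: Bw_def)
      qed
      then show "x \<in> R" using w r by (auto simp: R_def A_def)
    qed
  qed (use finA in auto)
  then have 2: "card Bw * ((q - 1) * q ^ (L - k - l k)) \<le> card R"
    using D by (simp add: card_cartesian_product card_words q_def)
  \<comment> \<open>Since q <= 2 (q - 1), demanding a digit other than c before the block costs at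
    most a factor 2; this is the 2 in the bound.\<close>
  have "q ^ (L - k + 1) \<le> (q - 1) * q ^ (L - k - l k) * (2 * q ^ l k)"
  proof -
    have "q ^ (L - k + 1) = q * q ^ (L - k - l k) * q ^ l k"
      using kL by (simp add: power_add[symmetric] mult.assoc)
    also have "\<dots> \<le> (2 * (q - 1)) * q ^ (L - k - l k) * q ^ l k"
      using D by (intro mult_right_mono) (auto simp: q_def)
    finally show ?thesis by (simp add: mult_ac)
  qed
  then have "card (A k) \<le> card Bw * ((q - 1) * q ^ (L - k - l k)) * (2 * q ^ l k)"
    using 1 by (metis (no_types, lifting) mult.assoc mult_le_mono2 order_trans)
  also have "\<dots> \<le> card R * (2 * q ^ l k)" using 2 by (intro mult_right_mono) auto
  finally have "real (card (A k)) \<le> real (card R) * (2 * real q ^ l k)"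
    by (metis (mono_tags, lifting) of_nat_le_iff of_nat_mult of_nat_numeral of_nat_power)
  then have 3: "real (card (A k)) / (2 * real q ^ l k) \<le> real (card R)"
    using D by (simp add: divide_le_eq q_def)
  have "A k = R \<union> A (Suc k)" "R \<inter> A (Suc k) = {}"
    using k by (auto simp: A_def R_def less_Suc_eq)
  then have "card (A k) = card R + card (A (Suc k))"
    using finA card_Un_disjoint by metis
  then show ?thesis using 3 by (simp add: q_def algebra_simps)
qed

text \<open>The factors 1 - p of \<open>card_avoid_step\<close> multiply up, and 1 - p <= exp (- p):
  a second Borel-Cantelli lemma in counting form.\<close>

lemma card_avoid_le:
  assumes D: "finite D" "c \<in> D" "2 \<le> card D" and fin: "finite S"
    and S: "\<And>j. j \<in> S \<Longrightarrow> 1 \<le> j \<and> j + l j \<le> L"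
  shows "real (card {x \<in> words D L. \<forall>j\<in>S. \<not> run c l j x})
    \<le> real (card D) ^ L * exp (- (\<Sum>j\<in>S. 1 / (2 * real (card D) ^ l j)))"
proof -
  define A where "A \<equiv> \<lambda>k. {x \<in> words D L. \<forall>j\<in>S. j < k \<longrightarrow> \<not> run c l j x}"
  define p where "p \<equiv> \<lambda>j. 1 / (2 * real (card D) ^ l j)"
  have "real (card (A k)) \<le> real (card D) ^ L * exp (- (\<Sum>j\<in>{j\<in>S. j < k}. p j))" for k
  proof (induction k)
    case 0
    then show ?case using card_words[OF D(1), of L] by (simp add: A_def)
  next
    case (Suc k)
    show ?case
    proof (cases "k \<in> S")
      case True
      have "{j \<in> S. j < Suc k} = insert k {j \<in> S. j < k}" using True by auto
      then have s: "(\<Sum>j\<in>{j\<in>S. j < Suc k}. p j) = p k + (\<Sum>j\<in>{j\<in>S. j < k}. p j)"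
        using fin by simp
      have "real (card (A (Suc k))) \<le> (1 - p k) * real (card (A k))"
        unfolding A_def p_def by (rule card_avoid_step[OF D S True])
      also have "\<dots> \<le> exp (- p k) * real (card (A k))"
        using exp_ge_add_one_self[of "- p k"] by (intro mult_right_mono) auto
      also have "\<dots> \<le> exp (- p k) * (real (card D) ^ L * exp (- (\<Sum>j\<in>{j\<in>S. j < k}. p j)))"
        by (intro mult_left_mono Suc.IH) auto
      also have "\<dots> = real (card D) ^ L * exp (- (\<Sum>j\<in>{j\<in>S. j < Suc k}. p j))"
        by (simp add: s exp_diff exp_minus field_simps)
      finally show ?thesis .
    next
      case False
      then have "{j \<in> S. j < Suc k} = {j \<in> S. j < k}" by (auto simp: less_Suc_eq)
      moreover have "A (Suc k) = A k" using False by (auto simp: A_def less_Suc_eq)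
      ultimately show ?thesis using Suc.IH by simp
    qed
  qed
  \<comment> \<open>Every j in \<open>S\<close> is at most L, so the restriction j < L + 1 is
    void.\<close>
  from this[of "L + 1"] have "real (card (A (L + 1))) \<le>
      real (card D) ^ L * exp (- (\<Sum>j\<in>{j\<in>S. j < L + 1}. p j))" .
  moreover have "{j\<in>S. j < L + 1} = S" using S by force
  moreover have "A (L + 1) = {x \<in> words D L. \<forall>j\<in>S. \<not> run c l j x}"
    using S unfolding A_def by force
  ultimately show ?thesis by (simp add: p_def)
qed

section \<open>First runs and the descent\<close>

text \<open>The words are cut exactly where the run at k ends. Over all k in \<open>S\<close> this
  gives an antichain of extensions of \<open>w\<close>, each belonging to one level only.\<close>

definition first_runs :: "nat set \<Rightarrow> nat \<Rightarrow> (nat \<Rightarrow> nat) \<Rightarrow> nat set \<Rightarrow> nat list \<Rightarrow> nat \<Rightarrow> nat list set" where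
  "first_runs D c l S w k =
    {y \<in> words D (k + l k). prefix w y \<and> run c l k y \<and> (\<forall>j\<in>S. j < k \<longrightarrow> \<not> run c l j y)}"

text \<open>The weight of the part of the cover at or below \<open>w\<close>. The set
  \<open>V i\<close> is meant to hold the cylinders that meet the i-th covering set, so a word is
  counted once for each i.\<close>

definition word_content :: "(nat \<Rightarrow> real) \<Rightarrow> (nat \<Rightarrow> nat list set) \<Rightarrow> nat list \<Rightarrow> ennreal" where
  "word_content \<phi> V w = (\<Sum>i. \<Sum>v\<in>{v \<in> V i. prefix w v}. ennreal (\<phi> (length v)))"

lemma finite_first_runs: "finite D \<Longrightarrow> finite (first_runs D c l S w k)"
  using finite_words by (simp add: first_runs_def)

lemma length_first_runs: "y \<in> first_runs D c l S w k \<Longrightarrow> length y = k + l k"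
  by (simp add: first_runs_def words_def)

text \<open>If k < k', the run of y persists in y', which has none before k'. If k' < k, the digit
  before k makes the run of y' end before k, so that y' would be shorter than y.\<close>

lemma first_runs_antichain:
  assumes "y \<in> first_runs D c l S w k" "y' \<in> first_runs D c l S w k'" "k \<in> S" "k' \<in> S" "prefix y y'"
  shows "y = y' \<and> k = k'"
proof -
  have run: "run c l k y'" "run c l k' y'"
    using assms run_prefix by (auto simp: first_runs_def)
  have len: "length y = k + l k" "length y' = k' + l k'"
    using assms length_first_runs by auto
  have "\<not> k < k'" using assms run by (auto simp: first_runs_def)
  moreover have "\<not> k' < k"
  proof
    assume "k' < k"
    moreover have "y' ! (k - 1) \<noteq> c" using run by (auto simp: run_def)
    ultimately have "k' + l k' < k" using run_disjoint run(2) by blast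
    then show False using len prefix_length_le[OF assms(5)] by auto
  qed
  ultimately have "k = k'" by auto
  then show ?thesis using len assms(5) by (metis append_eq_conv_conj prefix_def take_all order_refl)
qed

text \<open>The quarter is 1 - 1/2 - 1/4. Before the forced block is appended, at most 1/q <= 1/2 of
  the extensions of \<open>w\<close> to length k have the digit c at k - 1, and at most the
  proportion 1 / q^(l j) has a run at an earlier j; these add up to at most 1/4 by
  hypothesis.\<close>

lemma card_first_runs_ge:
  assumes D: "finite D" "c \<in> D" "2 \<le> card D" and w: "w \<in> words D n"
    and S: "finite S" "\<And>j. j \<in> S \<Longrightarrow> n < j" "(\<Sum>j\<in>S. 1 / real (card D) ^ l j) \<le> 1 / 4"
    and k: "k \<in> S"
  shows "real (card D) ^ (k - n) / 4 \<le> real (card (first_runs D c l S w k))"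
proof -
  define q where "q = card D"
  have q: "q \<ge> 2" "real q > 0" using D by (auto simp: q_def)
  have nk: "n < k" using S k by auto
  define U where "U = {u \<in> words D k. prefix w u \<and> u ! (k - 1) \<noteq> c \<and> (\<forall>j\<in>S. j < k \<longrightarrow> \<not> run c l j u)}"
  define C where "C \<equiv> \<lambda>j m. {u \<in> words D k. prefix w u \<and> (\<forall>i\<in>{j..<j + m}. u ! i = c)}"
  define J where "J = {j \<in> S. j < k \<and> j + l j \<le> k}"
  have fin: "finite U" "\<And>j m. finite (C j m)" "finite J"
    using finite_words[OF D(1)] S by (auto simp: U_def C_def J_def)
  have 1: "card U \<le> card (first_runs D c l S w k)"
  proof (rule card_inj_on_le)
    show "inj_on (\<lambda>u. u @ replicate (l k) c) U" by (auto simp: inj_on_def)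
    show "(\<lambda>u. u @ replicate (l k) c) ` U \<subseteq> first_runs D c l S w k"
    proof
      fix y assume "y \<in> (\<lambda>u. u @ replicate (l k) c) ` U"
      then obtain u where u: "u \<in> U" "y = u @ replicate (l k) c" by auto
      have len: "length u = k" "length y = k + l k" using u by (auto simp: U_def words_def)
      have y: "y \<in> words D (k + l k)"
        using u words_append replicate_words[OF D(2)] by (auto simp: U_def)
      have yk: "y ! (k - 1) \<noteq> c" using u nk len by (auto simp: U_def nth_append)
      have "run c l k y" using yk nk len u(2) by (auto simp: run_def nth_append)
      moreover have "\<not> run c l j y" if j: "j \<in> S" "j < k" for j
      proof
        assume r: "run c l j y"
        then have "j + l j < k" using run_disjoint yk j by blast
        then have "run c l j u" using r u(2) len run_append by simp
        then show False using j u by (auto simp: U_def)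
      qed
      ultimately show "y \<in> first_runs D c l S w k"
        using y u by (auto simp: first_runs_def U_def)
    qed
  qed (rule finite_first_runs[OF D(1)])
  have "{u \<in> words D k. prefix w u} \<subseteq> U \<union> C (k - 1) 1 \<union> (\<Union>j\<in>J. C j (l j))"
  proof
    fix u assume u: "u \<in> {u \<in> words D k. prefix w u}"
    show "u \<in> U \<union> C (k - 1) 1 \<union> (\<Union>j\<in>J. C j (l j))"
    proof (cases "u \<in> U \<or> u ! (k - 1) = c")
      case True
      have "{k - 1..<k - 1 + 1} = {k - 1}" by auto
      then show ?thesis using u True by (auto simp: C_def)
    next
      case False
      then obtain j where j: "j \<in> S" "j < k" "run c l j u" using u by (auto simp: U_def)
      then have "j \<in> J" "u \<in> C j (l j)" using u by (auto simp: J_def C_def run_def words_def)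
      then show ?thesis by blast
    qed
  qed
  then have "card {u \<in> words D k. prefix w u} \<le> card (U \<union> C (k - 1) 1 \<union> (\<Union>j\<in>J. C j (l j)))"
    using fin by (intro card_mono) auto
  also have "\<dots> \<le> card U + card (C (k - 1) 1) + card (\<Union>j\<in>J. C j (l j))"
    by (meson add_mono card_Un_le order_refl order_trans)
  also have "\<dots> \<le> card U + q ^ (k - n - 1) + (\<Sum>j\<in>J. q ^ (k - n - l j))"
  proof (intro add_mono order_refl)
    show "card (C (k - 1) 1) \<le> q ^ (k - n - 1)"
      unfolding C_def q_def by (rule card_extensions_constant_le[OF D(1) w]) (use nk in auto)
    have "card (\<Union>j\<in>J. C j (l j)) \<le> (\<Sum>j\<in>J. card (C j (l j)))"
      by (rule card_UN_le[OF fin(3)])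
    also have "\<dots> \<le> (\<Sum>j\<in>J. q ^ (k - n - l j))"
      unfolding C_def q_def
      by (intro sum_mono card_extensions_constant_le[OF D(1) w]) (use S(2) in \<open>auto simp: J_def less_imp_le\<close>)
    finally show "card (\<Union>j\<in>J. C j (l j)) \<le> (\<Sum>j\<in>J. q ^ (k - n - l j))" .
  qed
  finally have "q ^ (k - n) \<le> card U + q ^ (k - n - 1) + (\<Sum>j\<in>J. q ^ (k - n - l j))"
    using card_extensions[OF D(1) w, of k] nk by (simp add: q_def)
  then have "real (q ^ (k - n)) \<le> real (card U + q ^ (k - n - 1) + (\<Sum>j\<in>J. q ^ (k - n - l j)))"
    by (rule of_nat_mono)
  then have 2: "real q ^ (k - n) \<le> real (card U) + real q ^ (k - n - 1) + (\<Sum>j\<in>J. real q ^ (k - n - l j))"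
    by simp
  have 3: "real q ^ (k - n - 1) \<le> real q ^ (k - n) / 2"
  proof -
    have "real q ^ (k - n) = real q * real q ^ (k - n - 1)"
      using nk by (metis Suc_diff_1 power_Suc zero_less_diff)
    then show ?thesis using q(1) by simp
  qed
  have "(\<Sum>j\<in>J. real q ^ (k - n - l j)) = (\<Sum>j\<in>J. real q ^ (k - n) * (1 / real q ^ l j))"
  proof (intro sum.cong refl)
    fix j assume "j \<in> J"
    then have "l j \<le> k - n" using S(2)[of j] by (auto simp: J_def)
    then show "real q ^ (k - n - l j) = real q ^ (k - n) * (1 / real q ^ l j)"
      using q power_diff[of "real q" "l j" "k - n"] by simp
  qed
  also have "\<dots> = real q ^ (k - n) * (\<Sum>j\<in>J. 1 / real q ^ l j)"
    by (rule sum_distrib_left[symmetric])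
  also have "\<dots> \<le> real q ^ (k - n) * (1 / 4)"
  proof (intro mult_left_mono)
    have "(\<Sum>j\<in>J. 1 / real q ^ l j) \<le> (\<Sum>j\<in>S. 1 / real q ^ l j)"
      using S by (intro sum_mono2) (auto simp: J_def)
    then show "(\<Sum>j\<in>J. 1 / real q ^ l j) \<le> 1 / 4" using S(3) by (simp add: q_def)
  qed (use q in auto)
  finally have "real q ^ (k - n) / 4 \<le> real (card U)" using 2 3 by simp
  then show ?thesis using 1 unfolding q_def by linarith
qed

text \<open>If k >= |v|, a word y is determined by its first k digits, of which k - |v| are free;
  this gives the first term. If k < |v| < |y|, the word v ends inside the block of y, so k - 1 is
  the last position in v with a digit other than c. Thus v determines k and y, and this single word
  weighs at most \<phi>(|v|).\<close>

lemma sum_first_runs_below_le: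
  fixes F :: "nat \<Rightarrow> real" and l :: "nat \<Rightarrow> nat"
  assumes D: "finite D" "c \<in> D" "2 \<le> card D" and S: "finite S"
    and F: "\<And>n. 0 < F n"
    and \<phi>: "\<And>n. \<phi> n = F n / real (card D) ^ n" and anti: "antimono \<phi>"
  shows "(\<Sum>k\<in>S. \<Sum>y\<in>{y \<in> first_runs D c l S w k. strict_prefix v y}. \<phi> (length y))
      \<le> (\<Sum>k\<in>S. F (k + l k) / real (card D) ^ l k) / real (card D) ^ length v + \<phi> (length v)"
proof -
  define q where "q = card D"
  have q: "real q > 0" using D by (auto simp: q_def)
  have \<phi>0: "0 < \<phi> n" for n using F[of n] q by (simp add: \<phi> q_def)
  define T where "T \<equiv> \<lambda>k. {y \<in> first_runs D c l S w k. strict_prefix v y}"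
  define j where "j = length v"
  have finT: "finite (T k)" for k using finite_first_runs[OF D(1)] by (simp add: T_def)
  define S1 where "S1 = {k \<in> S. j \<le> k}"
  define S2 where "S2 = {k \<in> S. k < j}"
  have A: "(\<Sum>y\<in>T k. \<phi> (length y)) \<le> (F (k + l k) / real q ^ l k) / real q ^ j" if k: "k \<in> S1" for k
  proof (cases "T k = {}")
    case True
    then show ?thesis using F[of "k + l k"] q by (simp add: divide_nonneg_nonneg less_imp_le)
  next
    case False
    have "v \<in> words D j"
      using False by (force simp: T_def first_runs_def j_def words_def strict_prefix_def prefix_def)
    have "card (T k) \<le> card {u \<in> words D k. prefix v u}"
    proof (rule card_inj_on_le)
      have eq: "y = take k y @ replicate (l k) c" if "y \<in> T k" for y
      proof -
        have y: "length y = k + l k" "run c l k y"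
          using that by (simp_all add: T_def first_runs_def words_def)
        have "drop k y = replicate (l k) c"
        proof (rule nth_equalityI)
          fix i assume "i < length (drop k y)"
          then show "drop k y ! i = replicate (l k) c ! i" using y by (simp add: run_def)
        qed (use y in simp)
        then show ?thesis by (metis append_take_drop_id)
      qed
      show "inj_on (take k) (T k)"
      proof (rule inj_onI)
        fix x y assume "x \<in> T k" "y \<in> T k" and h: "take k x = take k y"
        from eq[OF this(1)] eq[OF this(2)] show "x = y" unfolding h by (rule trans[OF _ sym])
      qed
      show "take k ` T k \<subseteq> {u \<in> words D k. prefix v u}"
      proof
        fix u assume "u \<in> take k ` T k"
        then obtain y where y: "y \<in> words D (k + l k)" "prefix v y" "u = take k y"
          by (auto simp: T_def first_runs_def strict_prefix_def)
        have "prefix v (take k y)"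
          using y(2) k by (auto simp: prefix_def S1_def j_def)
        then show "u \<in> {u \<in> words D k. prefix v u}"
          using y take_words[OF y(1), of k] by simp
      qed
    qed (use finite_words[OF D(1)] in auto)
    also have "\<dots> = q ^ (k - j)"
      using card_extensions[OF D(1) \<open>v \<in> words D j\<close>] k by (simp add: S1_def q_def)
    finally have c: "real (card (T k)) \<le> real q ^ (k - j)"
      by (metis of_nat_le_iff of_nat_power)
    have "(\<Sum>y\<in>T k. \<phi> (length y)) = (\<Sum>y\<in>T k. \<phi> (k + l k))"
      by (intro sum.cong) (auto simp: T_def length_first_runs)
    also have "\<dots> = real (card (T k)) * \<phi> (k + l k)" by simp
    also have "\<dots> \<le> real q ^ (k - j) * \<phi> (k + l k)"
      using c \<phi>0 by (intro mult_right_mono) (auto simp: less_imp_le)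
    also have "\<dots> = (F (k + l k) / real q ^ l k) / real q ^ j"
      using k q by (simp add: S1_def \<phi> q_def[symmetric] power_diff power_add)
    finally show ?thesis .
  qed
  have B: "(\<Sum>k\<in>S2. \<Sum>y\<in>T k. \<phi> (length y)) \<le> \<phi> j"
  proof -
    define Y where "Y = (\<Union>k\<in>S2. T k)"
    have "(\<Sum>k\<in>S2. \<Sum>y\<in>T k. \<phi> (length y)) = (\<Sum>y\<in>Y. \<phi> (length y))"
      unfolding Y_def
    proof (rule sum.UNION_disjoint[symmetric])
      show "\<forall>k\<in>S2. \<forall>k'\<in>S2. k \<noteq> k' \<longrightarrow> T k \<inter> T k' = {}"
        using first_runs_antichain by (fastforce simp: T_def S2_def)
    qed (use S finT in \<open>auto simp: S2_def\<close>)
    also have "\<dots> \<le> \<phi> j"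
    proof (cases "Y = {}")
      case True
      then show ?thesis using \<phi>0 by (simp add: less_imp_le)
    next
      case False
      then obtain y where y: "y \<in> Y" by auto
      have memT: "run c l k x \<and> length x = k + l k \<and> prefix v x \<and> j < length x" if "x \<in> T k" for x k
        using that prefix_length_less[of v x]
        by (simp add: T_def first_runs_def words_def j_def strict_prefix_def)
      have pv: "x ! i = v ! i" if "prefix v x" "i < j" for x i
        using that by (auto simp: prefix_def nth_append j_def)
      \<comment> \<open>Position k' - 1 lies in v, so y and y' agree there. The block of y starts at
        or before it and runs past the end of v, which makes the digit c, whereas the run of y'
        needs another digit.\<close>
      have main: False if "y \<in> T k" "y' \<in> T k'" "k \<in> S2" "k' \<in> S2" "k < k'" for y y' k k'
      proof -
        have r: "run c l k y" "run c l k' y'" "length y = k + l k" "prefix v y" "prefix v y'" "j < length y"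
          using memT[OF that(1)] memT[OF that(2)] by simp_all
        have k': "k \<le> k' - 1" "k' - 1 < j" using that by (auto simp: S2_def)
        then have "y ! (k' - 1) = y' ! (k' - 1)" using pv r by metis
        moreover have "y ! (k' - 1) = c" using r k' by (simp add: run_def)
        ultimately show False using r(2) by (simp add: run_def)
      qed
      have "y' = y" if y': "y' \<in> Y" for y'
      proof -
        obtain k k' where k: "k \<in> S2" "y \<in> T k" "k' \<in> S2" "y' \<in> T k'"
          using y y' by (auto simp: Y_def)
        then have "k = k'" using main by (metis linorder_neqE_nat)
        have r: "run c l k y" "run c l k y'" "length y = k + l k" "length y' = k + l k"
            "prefix v y" "prefix v y'" "k < j"
          using memT[OF k(2)] memT[OF k(4)] k(1) by (simp_all add: \<open>k = k'\<close> S2_def)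
        show ?thesis
        proof (rule nth_equalityI)
          fix i assume i: "i < length y'"
          show "y' ! i = y ! i"
          proof (cases "i < j")
            case True
            then show ?thesis using r pv by metis
          next
            case False
            then show ?thesis using r i by (simp add: run_def)
          qed
        qed (use r in auto)
      qed
      then have "Y = {y}" using y by blast
      moreover have "j \<le> length y"
        using y memT unfolding Y_def by (meson UN_E less_imp_le)
      ultimately show ?thesis using antimonoD[OF anti] by simp
    qed
    finally show ?thesis .
  qed
  have "(\<Sum>k\<in>S. \<Sum>y\<in>T k. \<phi> (length y)) = (\<Sum>k\<in>S1 \<union> S2. \<Sum>y\<in>T k. \<phi> (length y))"
    by (intro sum.cong) (auto simp: S1_def S2_def)
  also have "\<dots> = (\<Sum>k\<in>S1. \<Sum>y\<in>T k. \<phi> (length y)) + (\<Sum>k\<in>S2. \<Sum>y\<in>T k. \<phi> (length y))"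
    using S by (intro sum.union_disjoint) (auto simp: S1_def S2_def)
  also have "\<dots> \<le> (\<Sum>k\<in>S1. (F (k + l k) / real q ^ l k) / real q ^ j) + \<phi> j"
    using A B by (intro add_mono sum_mono) auto
  also have "(\<Sum>k\<in>S1. (F (k + l k) / real q ^ l k) / real q ^ j) \<le> (\<Sum>k\<in>S. (F (k + l k) / real q ^ l k) / real q ^ j)"
    using S F q by (intro sum_mono2) (auto simp: S1_def divide_nonneg_nonneg less_imp_le)
  finally show ?thesis
    by (simp add: T_def j_def q_def sum_divide_distrib)
qed

text \<open>The conclusion restores the hypotheses on \<open>w\<close> for the longer word
  \<open>y\<close>, so the step can be iterated. If no word qualified, the cover words below
  \<open>w\<close> would have to pay for the whole antichain of first runs. The threshold 1/8 is
  half of the proportion 1/4 that the antichain retains, and the hypothesis on 9 F(n) uses up this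
  factor 2.\<close>

lemma descent_step:
  fixes F :: "nat \<Rightarrow> real" and l :: "nat \<Rightarrow> nat"
  assumes D: "finite D" "c \<in> D" "2 \<le> card D"
    and F: "\<And>n. 0 < F n" "incseq F"
    and \<phi>: "\<And>n. \<phi> n = F n / real (card D) ^ n" and anti: "antimono \<phi>"
    and S: "finite S" "\<And>j. j \<in> S \<Longrightarrow> n < j" "(\<Sum>j\<in>S. 1 / real (card D) ^ l j) \<le> 1 / 4"
      "9 * F n \<le> (\<Sum>k\<in>S. F (k + l k) / real (card D) ^ l k)"
    and V: "\<And>i. finite (V i)"
    and w: "w \<in> words D n" "word_content \<phi> V w < ennreal (\<phi> n / 8)"
      "\<And>i v. v \<in> V i \<Longrightarrow> \<not> strict_prefix v w"
  shows "\<exists>k\<in>S. \<exists>y\<in>words D (k + l k). prefix w y \<and> run c l k y \<and>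
      word_content \<phi> V y < ennreal (\<phi> (k + l k) / 8) \<and> (\<forall>i. \<forall>v\<in>V i. \<not> strict_prefix v y)"
proof (rule ccontr)
  assume contra: "\<not> ?thesis"
  define q where "q = card D"
  have q: "real q > 0" using D by (auto simp: q_def)
  have \<phi>0: "0 < \<phi> n" for n using F(1)[of n] q by (simp add: \<phi> q_def)
  define A where "A = (\<Sum>k\<in>S. F (k + l k) / real q ^ l k)"
  have A0: "A \<ge> 0" unfolding A_def using F q by (intro sum_nonneg) (simp add: less_imp_le)
  \<comment> \<open>A cover word v spoils words of T of total weight at most K times its own: the words strictly below
    v weigh at most (A / F n + 1) \<open>\<phi>\<close>(|v|), and v itself counts 8-fold towards the one word above it.
    As T weighs at least A / (4 q^n), the hypothesis 9 F n \<open>\<le>\<close> A leaves an unspoilt word.\<close>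
  define K where "K = A / F n + 9"
  have K0: "K > 0" using A0 F(1)[of n] unfolding K_def by (intro add_nonneg_pos) (auto simp: less_imp_le)
  define T where "T = (\<Union>k\<in>S. first_runs D c l S w k)"
  have finT: "finite T" using S finite_first_runs[OF D(1)] by (auto simp: T_def)
  have disj: "\<forall>k\<in>S. \<forall>k'\<in>S. k \<noteq> k' \<longrightarrow> first_runs D c l S w k \<inter> first_runs D c l S w k' = {}"
    using first_runs_antichain[of _ D c l S w] by (metis disjoint_iff prefix_order.refl)
  have sumT: "sum g T = (\<Sum>k\<in>S. sum g (first_runs D c l S w k))" for g :: "nat list \<Rightarrow> real"
    unfolding T_def using S disj finite_first_runs[OF D(1)] by (intro sum.UNION_disjoint) auto
  have antichain: "y = y'" if "y \<in> T" "y' \<in> T" "prefix y y'" for y y'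
    using that first_runs_antichain[of y D c l S w _ y'] unfolding T_def by blast
  have lower: "A / (4 * real q ^ n) \<le> (\<Sum>y\<in>T. \<phi> (length y))"
  proof -
    have "A / (4 * real q ^ n) = (\<Sum>k\<in>S. real q ^ (k - n) / 4 * \<phi> (k + l k))"
      unfolding A_def sum_divide_distrib
    proof (intro sum.cong refl)
      fix k assume "k \<in> S"
      then have "real q ^ k = real q ^ (k - n) * real q ^ n"
        using S(2)[of k] by (simp add: power_add[symmetric])
      then show "F (k + l k) / real q ^ l k / (4 * real q ^ n) = real q ^ (k - n) / 4 * \<phi> (k + l k)"
        using q by (simp add: \<phi> q_def[symmetric] power_add)
    qed
    also have "\<dots> \<le> (\<Sum>k\<in>S. \<Sum>y\<in>first_runs D c l S w k. \<phi> (length y))"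
    proof (intro sum_mono)
      fix k assume k: "k \<in> S"
      have "real q ^ (k - n) / 4 * \<phi> (k + l k) \<le> real (card (first_runs D c l S w k)) * \<phi> (k + l k)"
        using card_first_runs_ge[where l=l, OF D w(1) S(1,2,3) k] \<phi>0[of "k + l k"]
        by (intro mult_right_mono) (auto simp: q_def)
      also have "\<dots> = (\<Sum>y\<in>first_runs D c l S w k. \<phi> (k + l k))" by simp
      also have "\<dots> = (\<Sum>y\<in>first_runs D c l S w k. \<phi> (length y))"
        by (intro sum.cong) (auto simp: length_first_runs)
      finally show "real q ^ (k - n) / 4 * \<phi> (k + l k) \<le> (\<Sum>y\<in>first_runs D c l S w k. \<phi> (length y))" .
    qed
    finally show ?thesis by (simp add: sumT)
  qed
  \<comment> \<open>The charge of v for spoiling y: the full weight of y if v is a strict prefix of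
    y, and otherwise 8 times its own weight if it lies at or below y, where spoiling means a content
    of at least \<phi>(|y|) / 8.\<close>
  define h :: "nat list \<Rightarrow> nat list \<Rightarrow> ennreal" where
    "h \<equiv> \<lambda>y v. (if strict_prefix v y then ennreal (\<phi> (length y)) else 0) +
      8 * (if prefix y v then ennreal (\<phi> (length v)) else 0)"
  define Vw where "Vw \<equiv> \<lambda>i. {v \<in> V i. prefix w v}"
  have finVw: "finite (Vw i)" for i using V by (simp add: Vw_def)
  have bad: "ennreal (\<phi> (length y)) \<le> (\<Sum>i. \<Sum>v\<in>Vw i. h y v)" if y: "y \<in> T" for y
  proof -
    obtain k where k: "k \<in> S" "y \<in> first_runs D c l S w k" using y by (auto simp: T_def)
    have yk: "y \<in> words D (k + l k)" "prefix w y" "run c l k y" "length y = k + l k"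
      using k(2) by (auto simp: first_runs_def words_def)
    have "(\<exists>i. \<exists>v\<in>V i. strict_prefix v y) \<or> \<not> word_content \<phi> V y < ennreal (\<phi> (k + l k) / 8)"
      using contra k(1) yk(1-3) by blast
    then consider i v where "v \<in> V i" "strict_prefix v y"
      | "\<not> word_content \<phi> V y < ennreal (\<phi> (length y) / 8)"
      using yk(4) by auto
    then show ?thesis
    proof cases
      case 1
      \<comment> \<open>Both v and w are prefixes of y, hence comparable, and v is not a strict
        prefix of w. So v is among the words counted by the content of w.\<close>
      have "prefix w v"
        using prefix_same_cases[OF yk(2), of v] 1 w(3)[of v i] by (auto simp: strict_prefix_def)
      then have v: "v \<in> Vw i" using 1 by (simp add: Vw_def)
      have "ennreal (\<phi> (length y)) \<le> h y v" using 1 by (simp add: h_def)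
      also have "\<dots> \<le> (\<Sum>v\<in>Vw i. h y v)" using v finVw by (intro member_le_sum) auto
      also have "\<dots> \<le> (\<Sum>i. \<Sum>v\<in>Vw i. h y v)"
        using sum_le_suminf[of "\<lambda>i. \<Sum>v\<in>Vw i. h y v" "{i}"] by simp
      finally show ?thesis .
    next
      case 2
      have "ennreal (\<phi> (length y)) = 8 * ennreal (\<phi> (length y) / 8)"
        by (simp add: ennreal_mult'[symmetric] flip: ennreal_numeral)
      also have "\<dots> \<le> 8 * word_content \<phi> V y" using 2 by (intro mult_left_mono) auto
      also have "\<dots> = (\<Sum>i. 8 * (\<Sum>v\<in>{v \<in> V i. prefix y v}. ennreal (\<phi> (length v))))"
        by (simp add: word_content_def)
      also have "\<dots> \<le> (\<Sum>i. \<Sum>v\<in>Vw i. h y v)"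
      proof (intro suminf_le allI)
        fix i
        have "8 * (\<Sum>v\<in>{v \<in> V i. prefix y v}. ennreal (\<phi> (length v))) =
            (\<Sum>v\<in>{v \<in> V i. prefix y v}. 8 * ennreal (\<phi> (length v)))"
          by (rule sum_distrib_left)
        also have "\<dots> \<le> (\<Sum>v\<in>{v \<in> V i. prefix y v}. h y v)"
          by (intro sum_mono) (simp add: h_def)
        also have "\<dots> \<le> (\<Sum>v\<in>Vw i. h y v)"
          using finVw yk(2) prefix_order.trans by (intro sum_mono2) (auto simp: Vw_def)
        finally show "8 * (\<Sum>v\<in>{v \<in> V i. prefix y v}. ennreal (\<phi> (length v))) \<le> (\<Sum>v\<in>Vw i. h y v)" .
      qed auto
      finally show ?thesis .
    qed
  qed
  have upper: "(\<Sum>y\<in>T. h y v) \<le> ennreal (K * \<phi> (length v))" if wv: "prefix w v" for v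
  proof -
    have n: "n \<le> length v" using prefix_length_le[OF wv] w(1) by (simp add: words_def)
    have "(\<Sum>y\<in>T. if strict_prefix v y then \<phi> (length y) else 0)
        = (\<Sum>k\<in>S. \<Sum>y\<in>{y \<in> first_runs D c l S w k. strict_prefix v y}. \<phi> (length y))"
      unfolding sumT by (intro sum.cong refl sum.inter_filter[symmetric] finite_first_runs D)
    also have "\<dots> \<le> A / real q ^ length v + \<phi> (length v)"
      using sum_first_runs_below_le[where l=l and F=F and \<phi>=\<phi>, OF D S(1) F(1) \<phi> anti] by (simp add: A_def q_def)
    also have "A / real q ^ length v \<le> A / F n * \<phi> (length v)"
    proof -
      \<comment> \<open>As F increases and |v| >= n, the factor F(|v|) / F(n) may be inserted; it
        turns q^-|v| into a multiple of the weight of v itself.\<close>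
      have "A * 1 \<le> A * (F (length v) / F n)"
        using A0 F(1)[of n] incseqD[OF F(2) n] by (intro mult_left_mono) auto
      then have "A / real q ^ length v \<le> A * (F (length v) / F n) / real q ^ length v"
        using q by (intro divide_right_mono) auto
      then show ?thesis by (simp add: \<phi> q_def)
    qed
    finally have 1: "(\<Sum>y\<in>T. if strict_prefix v y then \<phi> (length y) else 0)
      \<le> A / F n * \<phi> (length v) + \<phi> (length v)" by simp
    have 2: "(\<Sum>y\<in>T. if prefix y v then \<phi> (length v) else 0) \<le> \<phi> (length v)"
    proof -
      \<comment> \<open>Two prefixes of v are comparable, and T is an antichain.\<close>
      have "card {y \<in> T. prefix y v} \<le> 1"
      proof (rule ccontr)
        assume "\<not> card {y \<in> T. prefix y v} \<le> 1"
        then obtain y y' where y: "y \<in> T" "y' \<in> T" "prefix y v" "prefix y' v" "y \<noteq> y'"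
          using finT by (auto simp: card_le_Suc0_iff_eq)
        then show False using antichain prefix_same_cases by metis
      qed
      then have "real (card {y \<in> T. prefix y v}) * \<phi> (length v) \<le> 1 * \<phi> (length v)"
        using \<phi>0 by (intro mult_right_mono) (auto simp: less_imp_le)
      then show ?thesis using finT by (simp add: sum.inter_filter[symmetric])
    qed
    have "(\<Sum>y\<in>T. h y v) = (\<Sum>y\<in>T. ennreal ((if strict_prefix v y then \<phi> (length y) else 0) +
        8 * (if prefix y v then \<phi> (length v) else 0)))"
      using \<phi>0 by (intro sum.cong refl)
        (auto simp: h_def ennreal_mult' ennreal_plus less_imp_le)
    also have "\<dots> = ennreal (\<Sum>y\<in>T. (if strict_prefix v y then \<phi> (length y) else 0) +
        8 * (if prefix y v then \<phi> (length v) else 0))"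
      using \<phi>0 by (intro sum_ennreal) (simp add: less_imp_le)
    also have "\<dots> \<le> ennreal (K * \<phi> (length v))"
    proof (rule ennreal_leI)
      show "(\<Sum>y\<in>T. (if strict_prefix v y then \<phi> (length y) else 0) +
        8 * (if prefix y v then \<phi> (length v) else 0)) \<le> K * \<phi> (length v)"
        using 1 2 by (simp add: sum.distrib sum_distrib_left[symmetric] K_def algebra_simps)
    qed
    finally show ?thesis .
  qed
  \<comment> \<open>Double counting of the charges: summed over v, each y is paid for in full;
    summed over y, each v pays at most K times its weight.\<close>
  have "ennreal (A / (4 * real q ^ n)) \<le> ennreal (\<Sum>y\<in>T. \<phi> (length y))"
    using lower by (rule ennreal_leI)
  also have "\<dots> = (\<Sum>y\<in>T. ennreal (\<phi> (length y)))"
    using \<phi>0 by (intro sum_ennreal[symmetric]) (simp add: less_imp_le)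
  also have "\<dots> \<le> (\<Sum>y\<in>T. \<Sum>i. \<Sum>v\<in>Vw i. h y v)"
    by (intro sum_mono bad)
  also have "\<dots> = (\<Sum>i. \<Sum>y\<in>T. \<Sum>v\<in>Vw i. h y v)"
    by (intro suminf_sum[symmetric]) auto
  also have "\<dots> = (\<Sum>i. \<Sum>v\<in>Vw i. \<Sum>y\<in>T. h y v)"
    by (intro suminf_cong sum.swap)
  also have "\<dots> \<le> (\<Sum>i. ennreal K * (\<Sum>v\<in>Vw i. ennreal (\<phi> (length v))))"
  proof (intro suminf_le allI)
    fix i
    have "(\<Sum>v\<in>Vw i. \<Sum>y\<in>T. h y v) \<le> (\<Sum>v\<in>Vw i. ennreal K * ennreal (\<phi> (length v)))"
      using upper K0 by (intro sum_mono) (auto simp: Vw_def ennreal_mult')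
    then show "(\<Sum>v\<in>Vw i. \<Sum>y\<in>T. h y v) \<le> ennreal K * (\<Sum>v\<in>Vw i. ennreal (\<phi> (length v)))"
      by (simp add: sum_distrib_left)
  qed auto
  also have "\<dots> = ennreal K * word_content \<phi> V w" by (simp add: word_content_def Vw_def)
  also have "\<dots> < ennreal K * ennreal (\<phi> n / 8)"
    using w(2) K0 by (intro ennreal_mult_strict_left_mono) auto
  also have "\<dots> = ennreal (K * (\<phi> n / 8))"
    using K0 by (intro ennreal_mult'[symmetric]) simp
  finally have "A / (4 * real q ^ n) < K * (\<phi> n / 8)"
    using A0 q by (subst (asm) ennreal_less_iff) auto
  moreover have "K * (\<phi> n / 8) = (A + 9 * F n) / (8 * real q ^ n)"
  proof -
    have "K = (A + 9 * F n) / F n"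
      using F(1)[of n] by (simp add: K_def field_simps)
    then show ?thesis using F(1)[of n] by (simp add: \<phi> q_def)
  qed
  moreover have "(A + 9 * F n) / (8 * real q ^ n) \<le> A / (4 * real q ^ n)"
  proof -
    have "(A + 9 * F n) / (8 * real q ^ n) \<le> (2 * A) / (8 * real q ^ n)"
      using S(4) q by (intro divide_right_mono) (auto simp: A_def q_def)
    then show ?thesis by simp
  qed
  ultimately show False by simp
qed

section \<open>Choice of finitely many levels from a divergent sum, and the iterated descent\<close>

lemma minimal_subset_sum_ge:
  fixes g :: "'a \<Rightarrow> real"
  assumes "finite S0" "R \<le> sum g S0" "0 < R"
  shows "\<exists>S x. S \<subseteq> S0 \<and> x \<in> S \<and> R \<le> sum g S \<and> sum g (S - {x}) < R"
  using assms
proof (induction S0 rule: finite_induct)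
  case (insert x S)
  show ?case
  proof (cases "R \<le> sum g S")
    case True
    then show ?thesis using insert.IH insert.prems by blast
  next
    case False
    then show ?thesis using insert by (intro exI[of _ "insert x S"] exI[of _ x]) auto
  qed
qed auto

lemma not_summable_on_imp_large_sums:
  fixes g :: "nat \<Rightarrow> real"
  assumes nonneg: "\<And>k. k \<in> S \<Longrightarrow> 0 \<le> g k" and div: "\<not> g summable_on S"
  shows "\<exists>T. finite T \<and> T \<subseteq> S \<and> (\<forall>k\<in>T. N \<le> k) \<and> R \<le> sum g T"
proof (rule ccontr)
  assume contra: "\<not> ?thesis"
  have "g summable_on {k \<in> S. N \<le> k}"
  proof (rule nonneg_bdd_above_summable_on)
    show "bdd_above (sum g ` {F. F \<subseteq> {k \<in> S. N \<le> k} \<and> finite F})"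
    proof (rule bdd_aboveI)
      fix x assume "x \<in> sum g ` {F. F \<subseteq> {k \<in> S. N \<le> k} \<and> finite F}"
      then obtain F where F: "x = sum g F" "finite F" "F \<subseteq> S" "\<forall>k\<in>F. N \<le> k" by auto
      then have "\<not> R \<le> sum g F" using contra by blast
      then show "x \<le> R" using F(1) by simp
    qed
  qed (use nonneg in auto)
  moreover have "g summable_on {k \<in> S. k < N}" by (intro summable_on_finite) auto
  ultimately have "g summable_on ({k \<in> S. N \<le> k} \<union> {k \<in> S. k < N})"
    by (intro summable_on_Un_disjoint) auto
  moreover have "{k \<in> S. N \<le> k} \<union> {k \<in> S. k < N} = S" by auto
  ultimately show False using div by simp
qed

text \<open>Beyond M the function F exceeds 8 R', so each term of the divergent sum is at least 8 R'
  / q^l. A finite set of such levels whose sum reaches R', but drops below R' without some x,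
  therefore has a sum of q^-l below 1/8 apart from x; the term of x adds at most 1/8.\<close>

lemma select_levels:
  fixes F :: "nat \<Rightarrow> real" and l :: "nat \<Rightarrow> nat" and q :: real
  assumes q: "2 \<le> q" and F: "\<And>n. 0 < F n" "incseq F" "\<And>B. \<exists>n. B < F n"
    and l: "\<And>k. k \<in> S \<Longrightarrow> 3 \<le> l k"
    and div: "\<not> (\<lambda>k. F (k + l k) / q ^ l k) summable_on S"
  shows "\<exists>T. finite T \<and> T \<subseteq> S \<and> (\<forall>k\<in>T. N < k) \<and> (\<Sum>k\<in>T. 1 / q ^ l k) \<le> 1 / 4 \<and>
    R \<le> (\<Sum>k\<in>T. F (k + l k) / q ^ l k)"
proof -
  define g where "g \<equiv> \<lambda>k. F (k + l k) / q ^ l k"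
  \<comment> \<open>The maximum with 1 makes the target positive, as the division by R'
    requires.\<close>
  define R' where "R' = max R 1"
  have R'0: "0 < R'" by (simp add: R'_def)
  obtain M where M: "8 * R' < F M" using F(3) by auto
  have g0: "0 \<le> g k" for k using q F by (simp add: g_def less_imp_le)
  obtain T0 where T0: "finite T0" "T0 \<subseteq> S" "\<forall>k\<in>T0. max M (Suc N) \<le> k" "R' \<le> sum g T0"
    using not_summable_on_imp_large_sums[of S g "max M (Suc N)" R'] div g0
    unfolding g_def by blast
  obtain T x where T: "T \<subseteq> T0" "x \<in> T" "R' \<le> sum g T" "sum g (T - {x}) < R'"
    using minimal_subset_sum_ge[OF T0(1,4)] R'0 by blast
  have finT: "finite T" using T T0 finite_subset by blast
  have "8 * R' * (\<Sum>k\<in>T - {x}. 1 / q ^ l k) = (\<Sum>k\<in>T - {x}. 8 * R' * (1 / q ^ l k))"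
    by (rule sum_distrib_left)
  also have "\<dots> \<le> sum g (T - {x})"
  proof (rule sum_mono)
    fix k assume "k \<in> T - {x}"
    then have "M \<le> k + l k" using T T0 by force
    then have "8 * R' \<le> F (k + l k)" using M incseqD[OF F(2)] by force
    then show "8 * R' * (1 / q ^ l k) \<le> g k"
      using q by (simp add: g_def divide_right_mono)
  qed
  also have "\<dots> < R'" by (rule T)
  finally have "R' * (8 * (\<Sum>k\<in>T - {x}. 1 / q ^ l k)) < R' * 1" by (simp add: mult_ac)
  then have "8 * (\<Sum>k\<in>T - {x}. 1 / q ^ l k) < 1"
    by (subst (asm) mult_less_cancel_left_pos) (auto simp: R'_def)
  \<comment> \<open>Here \<open>l \<ge> 3\<close> is needed: the last level added must not exhaust the bound 1/4.\<close>
  moreover have "1 / q ^ l x \<le> 1 / 8"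
  proof -
    have "(8::real) = 2 ^ 3" by simp
    also have "\<dots> \<le> q ^ 3" using q by (intro power_mono) auto
    also have "\<dots> \<le> q ^ l x" using q l T T0 by (intro power_increasing) auto
    finally show ?thesis using q by (intro divide_left_mono) auto
  qed
  moreover have "(\<Sum>k\<in>T. 1 / q ^ l k) = 1 / q ^ l x + (\<Sum>k\<in>T - {x}. 1 / q ^ l k)"
    using finT T(2) by (rule sum.remove)
  ultimately have "(\<Sum>k\<in>T. 1 / q ^ l k) \<le> 1 / 4" by simp
  moreover have "\<forall>k\<in>T. N < k" using T(1) T0(3) by (auto simp: subset_iff Suc_le_eq)
  moreover have "R \<le> sum g T" using T(3) by (simp add: R'_def)
  ultimately show ?thesis using T(1) T0(2) finT unfolding g_def by blast
qed

text \<open>An average over the q^n words of length n: a cover word has length at least n, so it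
  lies below at most one of them, namely its own initial segment.\<close>

lemma descent_start:
  fixes V :: "nat \<Rightarrow> nat list set"
  assumes D: "finite D" "0 < card D"
    and \<phi>: "\<And>n. 0 < \<phi> n" and V: "\<And>i. finite (V i)" "\<And>i v. v \<in> V i \<Longrightarrow> n \<le> length v"
    and small: "(\<Sum>i. \<Sum>v\<in>V i. ennreal (\<phi> (length v))) < ennreal (real (card D) ^ n * (\<phi> n / 8))"
  shows "\<exists>w\<in>words D n. word_content \<phi> V w < ennreal (\<phi> n / 8)"
proof (rule ccontr)
  assume "\<not> ?thesis"
  then have ge: "ennreal (\<phi> n / 8) \<le> word_content \<phi> V w" if "w \<in> words D n" for w
    using that by (auto simp: not_less)
  have "ennreal (real (card D) ^ n * (\<phi> n / 8)) = ennreal (real (card D) ^ n) * ennreal (\<phi> n / 8)"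
    by (intro ennreal_mult') simp
  also have "\<dots> = (\<Sum>w\<in>words D n. ennreal (\<phi> n / 8))"
    by (simp add: card_words[OF D(1)] ennreal_of_nat_eq_real_of_nat)
  also have "\<dots> \<le> (\<Sum>w\<in>words D n. word_content \<phi> V w)"
    by (intro sum_mono ge)
  also have "\<dots> = (\<Sum>i. \<Sum>w\<in>words D n. \<Sum>v\<in>{v \<in> V i. prefix w v}. ennreal (\<phi> (length v)))"
    unfolding word_content_def by (intro suminf_sum[symmetric]) auto
  also have "\<dots> \<le> (\<Sum>i. \<Sum>v\<in>V i. ennreal (\<phi> (length v)))"
  proof (intro suminf_le allI)
    fix i
    have "(\<Sum>w\<in>words D n. \<Sum>v\<in>{v \<in> V i. prefix w v}. ennreal (\<phi> (length v)))
        = (\<Sum>w\<in>words D n. \<Sum>v\<in>V i. if prefix w v then ennreal (\<phi> (length v)) else 0)"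
      using V by (intro sum.cong refl sum.inter_filter)
    also have "\<dots> = (\<Sum>v\<in>V i. \<Sum>w\<in>words D n. if prefix w v then ennreal (\<phi> (length v)) else 0)"
      by (rule sum.swap)
    also have "\<dots> \<le> (\<Sum>v\<in>V i. ennreal (\<phi> (length v)))"
    proof (rule sum_mono)
      fix v assume v: "v \<in> V i"
      have "(\<Sum>w\<in>words D n. if prefix w v then ennreal (\<phi> (length v)) else 0)
         \<le> (\<Sum>w\<in>words D n. if w = take n v then ennreal (\<phi> (length v)) else 0)"
        by (intro sum_mono) (auto simp: words_def prefix_def)
      also have "\<dots> \<le> ennreal (\<phi> (length v))"
        using finite_words[OF D(1), of n] by simp
      finally show "(\<Sum>w\<in>words D n. if prefix w v then ennreal (\<phi> (length v)) else 0)
         \<le> ennreal (\<phi> (length v))" .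
    qed
    finally show "(\<Sum>w\<in>words D n. \<Sum>v\<in>{v \<in> V i. prefix w v}. ennreal (\<phi> (length v)))
      \<le> (\<Sum>v\<in>V i. ennreal (\<phi> (length v)))" .
  qed auto
  finally show False using small by simp
qed

text \<open>The bound F(n) / 8 equals q^n \<phi>(n) / 8, which is what the averaging start needs.
  The words W s grow along prefixes and have length at least s, hence converge to a sequence. A
  cover word that is an initial segment of the limit would be a strict prefix of some W s, against
  the invariant \<open>P\<close>.\<close>

lemma ex_limit_point_avoiding:
  fixes V :: "nat \<Rightarrow> nat list set" and F :: "nat \<Rightarrow> real" and l :: "nat \<Rightarrow> nat"
  assumes D: "finite D" "c \<in> D" "2 \<le> card D"
    and F: "\<And>n. 0 < F n" "incseq F" "\<And>B. \<exists>n. B < F n"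
    and \<phi>: "\<And>n. \<phi> n = F n / real (card D) ^ n" and anti: "antimono \<phi>"
    and l: "\<And>k. k \<in> S \<Longrightarrow> 3 \<le> l k"
    and div: "\<not> (\<lambda>k. F (k + l k) / real (card D) ^ l k) summable_on S"
    and V: "\<And>i. finite (V i)" "\<And>i v. v \<in> V i \<Longrightarrow> n \<le> length v"
    and small: "(\<Sum>i. \<Sum>v\<in>V i. ennreal (\<phi> (length v))) < ennreal (F n / 8)"
  shows "\<exists>\<omega>. (\<forall>k. \<omega> k \<in> D) \<and> (\<forall>N. \<exists>k\<in>S. N \<le> k \<and> (\<forall>i\<in>{k..<k + l k}. \<omega> i = c)) \<and>
    (\<forall>i. \<forall>v\<in>V i. v \<noteq> map \<omega> [0..<length v])"
proof -
  have q: "2 \<le> real (card D)" using D by simp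
  have \<phi>0: "0 < \<phi> n" for n using F(1)[of n] q by (simp add: \<phi>)
  define P where "P \<equiv> \<lambda>(s::nat) w. s \<le> length w \<and> set w \<subseteq> D \<and>
    word_content \<phi> V w < ennreal (\<phi> (length w) / 8) \<and> (\<forall>i. \<forall>v\<in>V i. \<not> strict_prefix v w)"
  define Q where "Q \<equiv> \<lambda>s w w'. prefix w w' \<and> (\<exists>k\<in>S. s \<le> k \<and> run c l k w')"
  have "\<exists>W. \<forall>s. P s (W s) \<and> Q s (W s) (W (Suc s))"
  proof (rule dependent_nat_choice)
    have "\<exists>w\<in>words D n. word_content \<phi> V w < ennreal (\<phi> n / 8)"
    proof (rule descent_start[OF D(1) _ \<phi>0 V])
      show "(\<Sum>i. \<Sum>v\<in>V i. ennreal (\<phi> (length v))) < ennreal (real (card D) ^ n * (\<phi> n / 8))"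
        using small q by (simp add: \<phi>)
    qed (use D in auto)
    then obtain w where w: "w \<in> words D n" "word_content \<phi> V w < ennreal (\<phi> n / 8)" by auto
    \<comment> \<open>Cover words have length at least n, the length of the first word.\<close>
    have "\<not> strict_prefix v w" if "v \<in> V i" for i v
      using V(2)[OF that] w(1) prefix_length_less[of v w] by (auto simp: words_def)
    then show "\<exists>w. P 0 w" using w by (intro exI[of _ w]) (auto simp: P_def words_def)
  next
    fix w s assume w: "P s w"
    define m where "m = length w"
    obtain T where T: "finite T" "T \<subseteq> S" "\<forall>k\<in>T. max s m < k"
        "(\<Sum>k\<in>T. 1 / real (card D) ^ l k) \<le> 1 / 4"
        "9 * F m \<le> (\<Sum>k\<in>T. F (k + l k) / real (card D) ^ l k)"
      \<comment> \<open>Levels beyond s make the runs recur infinitely often; levels beyond m = |w|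
        place them strictly below w.\<close>
      using select_levels[OF q F l div, of "max s m" "9 * F m"] by auto
    have "\<exists>k\<in>T. \<exists>y\<in>words D (k + l k). prefix w y \<and> run c l k y \<and>
      word_content \<phi> V y < ennreal (\<phi> (k + l k) / 8) \<and> (\<forall>i. \<forall>v\<in>V i. \<not> strict_prefix v y)"
      by (rule descent_step[OF D F(1,2) \<phi> anti T(1) _ T(4,5) V(1)])
        (use w T(3) in \<open>auto simp: P_def words_def m_def\<close>)
    then obtain k y where ky: "k \<in> T" "y \<in> words D (k + l k)" "prefix w y" "run c l k y"
      "word_content \<phi> V y < ennreal (\<phi> (k + l k) / 8)" "\<forall>i. \<forall>v\<in>V i. \<not> strict_prefix v y"
      by blast
    then have "s < k" using T by auto
    then have "P (Suc s) y" using ky by (simp add: P_def words_def)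
    moreover have "Q s w y"
      using ky T(2) \<open>s < k\<close> unfolding Q_def by (intro conjI bexI[of _ k]) auto
    ultimately show "\<exists>y. P (Suc s) y \<and> Q s w y" by blast
  qed
  then obtain W where W: "\<And>s. P s (W s)" "\<And>s. Q s (W s) (W (Suc s))" by blast
  define \<omega> where "\<omega> \<equiv> \<lambda>i. W (Suc i) ! i"
  have len: "s \<le> length (W s)" for s using W(1)[of s] by (simp add: P_def)
  have chain: "prefix (W s) (W s')" if "s \<le> s'" for s s'
    using that
  proof (induction s' rule: dec_induct)
    case (step m)
    then show ?case using W(2)[of m] prefix_order.trans by (auto simp: Q_def)
  qed simp
  have \<omega>: "W s ! i = \<omega> i" if "i < length (W s)" for s i
  proof -
    have "i < length (W (Suc i))" using len[of "Suc i"] by simp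
    then show ?thesis
      using that chain[of s "Suc i"] chain[of "Suc i" s] unfolding \<omega>_def
      by (cases "s \<le> Suc i") (auto simp: prefix_def nth_append)
  qed
  have in_D: "\<omega> i \<in> D" for i
    using W(1)[of "Suc i"] len[of "Suc i"] nth_mem[of i "W (Suc i)"] by (auto simp: P_def \<omega>_def)
  have runs: "\<exists>k\<in>S. N \<le> k \<and> (\<forall>i\<in>{k..<k + l k}. \<omega> i = c)" for N
  proof -
    obtain k where k: "k \<in> S" "N \<le> k" "run c l k (W (Suc N))" using W(2)[of N] by (auto simp: Q_def)
    have "\<omega> i = c" if "i \<in> {k..<k + l k}" for i
      using k(3) that \<omega>[of i "Suc N"] by (auto simp: run_def)
    then show ?thesis using k by blast
  qed
  have avoid: "v \<noteq> map \<omega> [0..<length v]" if v: "v \<in> V i" for i v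
  proof
    assume eq: "v = map \<omega> [0..<length v]"
    \<comment> \<open>One more than the length of v, so that W s extends v properly and the
      invariant on strict prefixes applies.\<close>
    define s where "s = Suc (length v)"
    have ls: "length v < length (W s)" using len[of s] by (simp add: s_def)
    have "v = take (length v) (W s)"
    proof (rule nth_equalityI)
      fix j assume j: "j < length v"
      then have "v ! j = \<omega> j" by (subst eq) simp
      then show "v ! j = take (length v) (W s) ! j" using j ls \<omega>[of j s] by simp
    qed (use ls in auto)
    then have "prefix v (W s)" by (metis take_is_prefix)
    then have "strict_prefix v (W s)" using ls by (auto simp: strict_prefix_def)
    moreover have "\<not> strict_prefix v (W s)" using W(1)[of s] v unfolding P_def by blast
    ultimately show False by contradiction
  qed
  show ?thesis
  proof (intro exI conjI allI ballI)
    show "\<omega> k \<in> D" for k by (rule in_D)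
    show "\<exists>k\<in>S. N \<le> k \<and> (\<forall>i\<in>{k..<k + l k}. \<omega> i = c)" for N by (rule runs)
    show "v \<noteq> map \<omega> [0..<length v]" if "v \<in> V i" for v i using avoid[OF that] .
  qed
qed

section \<open>Digit expansions\<close>

definition val :: "nat \<Rightarrow> (nat \<Rightarrow> nat) \<Rightarrow> real" where
  "val b \<omega> = (\<Sum>k. real (\<omega> k) / real b ^ Suc k)"

text \<open>The integer with base-b digits x: the cylinder of a word of length n lies in the
  interval from \<open>code b x / b^n\<close> to \<open>(code b x + 1) / b^n\<close>, so
  neighbouring cylinders have consecutive codes.\<close>

definition code :: "nat \<Rightarrow> nat list \<Rightarrow> nat" where
  "code b = foldl (\<lambda>s d. b * s + d) 0"

lemma code_Nil [simp]: "code b [] = 0"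
  and code_snoc [simp]: "code b (x @ [d]) = b * code b x + d"
  by (simp_all add: code_def)

lemma code_inject:
  assumes "length x = length y" "set x \<subseteq> {..<b}" "set y \<subseteq> {..<b}" "code b x = code b y"
  shows "x = y"
  using assms
proof (induction x arbitrary: y rule: rev_induct)
  case (snoc d x)
  then obtain y' e where y: "y = y' @ [e]" by (cases y rule: rev_cases) auto
  have "(b * code b x + d) mod b = (b * code b y' + e) mod b"
    using snoc.prems y by simp
  then have "d = e" using snoc.prems y by simp
  then show ?case using snoc.IH[of y'] snoc.prems y by auto
qed simp

text \<open>The constant expansion. Its value m / (b - 1) is the origin of the margin subtracted in
  both series.\<close>

lemma digit_series:
  assumes "b \<ge> 2"
  shows "(\<lambda>k. real m / real b ^ Suc k) sums (real m / (real b - 1))"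
proof -
  have "(\<lambda>k. (1 / real b) ^ k) sums (1 / (1 - 1 / real b))"
    using assms by (intro geometric_sums) auto
  from sums_mult[OF this, of "real m / real b"] have
    "(\<lambda>k. real m / real b * (1 / real b) ^ k) sums (real m / real b * (1 / (1 - 1 / real b)))" .
  moreover have "real m / real b * (1 / (1 - 1 / real b)) = real m / (real b - 1)"
    using assms by (simp add: field_simps)
  moreover have "(\<lambda>k. real m / real b * (1 / real b) ^ k) = (\<lambda>k. real m / real b ^ Suc k)"
    by (auto simp: power_divide)
  ultimately show ?thesis by (simp only:)
qed

lemma summable_val:
  assumes "b \<ge> 2" "\<And>k. \<omega> k < b"
  shows "summable (\<lambda>k. real (\<omega> k) / real b ^ Suc k)"
proof (rule summable_comparison_test')
  show "summable (\<lambda>k. real b / real b ^ Suc k)"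
    using digit_series[OF assms(1), of b] by (rule sums_summable)
  show "norm (real (\<omega> n) / real b ^ Suc n) \<le> real b / real b ^ Suc n" if "n \<ge> 0" for n
    using assms(2)[of n] by (auto simp del: power_Suc intro!: divide_right_mono)
qed

text \<open>Termwise comparison with the constant expansions. With M = b - 1 - m it keeps points of
  the Cantor set at distance at least m / (b - 1) from 0 and 1.\<close>

lemma val_bounds:
  assumes "b \<ge> 2" "\<And>k. m \<le> \<omega> k" "\<And>k. \<omega> k \<le> M" "M < b"
  shows "real m / (real b - 1) \<le> val b \<omega>" "val b \<omega> \<le> real M / (real b - 1)"
proof -
  have s: "summable (\<lambda>k. real (\<omega> k) / real b ^ Suc k)"
    using assms by (intro summable_val) (auto intro: le_less_trans)
  show "real m / (real b - 1) \<le> val b \<omega>"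
    unfolding sums_unique[OF digit_series[OF assms(1)]] val_def
    using assms by (intro suminf_le s sums_summable[OF digit_series] divide_right_mono) auto
  show "val b \<omega> \<le> real M / (real b - 1)"
    unfolding sums_unique[OF digit_series[OF assms(1)]] val_def
    using assms by (intro suminf_le s sums_summable[OF digit_series] divide_right_mono) auto
qed

lemma val_range:
  assumes "b \<ge> 2" "\<And>k. \<omega> k < b"
  shows "0 \<le> val b \<omega>" "val b \<omega> \<le> 1"
proof -
  have "\<omega> k \<le> b - 1" for k using assms(2)[of k] by auto
  then show "0 \<le> val b \<omega>" "val b \<omega> \<le> 1"
    using val_bounds[of b 0 \<omega> "b - 1"] assms by (auto simp: of_nat_diff)
qed

lemma val_Suc:
  assumes "b \<ge> 2" "\<And>k. \<omega> k < b"
  shows "val b \<omega> = (real (\<omega> 0) + val b (\<lambda>k. \<omega> (Suc k))) / real b"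
proof -
  have "val b \<omega> = (\<Sum>k. real (\<omega> (Suc k)) / real b ^ Suc (Suc k)) + real (\<omega> 0) / real b"
    unfolding val_def by (subst suminf_split_head[OF summable_val[OF assms]]) auto
  also have "(\<Sum>k. real (\<omega> (Suc k)) / real b ^ Suc (Suc k)) = val b (\<lambda>k. \<omega> (Suc k)) / real b"
    unfolding val_def using assms
    by (subst suminf_divide[OF summable_val, symmetric]) (auto simp: mult.commute)
  finally show ?thesis by (simp add: add_divide_distrib)
qed

text \<open>Self-similarity: after n digits a point is a level-n grid point plus b^-n times the
  value of its tail. Both parts of the theorem measure distances to grid points through this
  identity.\<close>

lemma val_split:
  assumes "b \<ge> 2" "\<And>k. \<omega> k < b"
  shows "val b \<omega> = (real (code b (map \<omega> [0..<n])) + val b (\<lambda>k. \<omega> (n + k))) / real b ^ n"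
proof (induction n)
  case (Suc n)
  have "val b (\<lambda>k. \<omega> (n + k)) = (real (\<omega> n) + val b (\<lambda>k. \<omega> (Suc n + k))) / real b"
    using val_Suc[of b "\<lambda>k. \<omega> (n + k)"] assms by simp
  then show ?case using Suc assms by (simp add: field_simps)
qed simp

lemma val_prefix_bounds:
  assumes "b \<ge> 2" "\<And>k. \<omega> k < b"
  shows "real (code b (map \<omega> [0..<n])) / real b ^ n \<le> val b \<omega>"
    "val b \<omega> \<le> (real (code b (map \<omega> [0..<n])) + 1) / real b ^ n"
  unfolding val_split[where \<omega> = \<omega> and n = n, OF assms]
  using val_range[of b "\<lambda>k. \<omega> (n + k)"] assms by (auto intro!: divide_right_mono)

lemma cantor_set_eq:
  assumes "b \<ge> 2" "D \<subseteq> {0..<b}"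
  shows "cantor_set b D = val b ` {\<omega>. \<forall>k. \<omega> k \<in> D}"
proof (intro set_eqI iffI)
  fix x assume "x \<in> cantor_set b D"
  then show "x \<in> val b ` {\<omega>. \<forall>k. \<omega> k \<in> D}"
    unfolding cantor_set_def val_def by (auto intro!: image_eqI sums_unique)
next
  fix x assume "x \<in> val b ` {\<omega>. \<forall>k. \<omega> k \<in> D}"
  then obtain \<omega> where \<omega>: "x = val b \<omega>" "\<And>k. \<omega> k \<in> D" by auto
  then have lt: "\<omega> k < b" for k using assms(2) by (force simp: subset_iff)
  then show "x \<in> cantor_set b D"
    unfolding cantor_set_def
    using \<omega> val_range[of b \<omega>, OF assms(1) lt] summable_sums[OF summable_val[of b \<omega>, OF assms(1) lt]]
    by (auto simp: val_def[symmetric] simp del: power_Suc)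
qed

lemma cylinder_diameter:
  assumes b: "b \<ge> 2" and Z: "\<And>\<omega>. \<omega> \<in> Z \<Longrightarrow> (\<forall>k. \<omega> k < b) \<and> map \<omega> [0..<n] = x"
  shows "bounded (val b ` Z)" "diameter (val b ` Z) \<le> 1 / real b ^ n"
proof -
  have sub: "val b ` Z \<subseteq> {real (code b x) / real b ^ n..real (code b x) / real b ^ n + 1 / real b ^ n}"
  proof
    fix y assume "y \<in> val b ` Z"
    then obtain \<omega> where \<omega>: "y = val b \<omega>" "\<And>k. \<omega> k < b" "map \<omega> [0..<n] = x" using Z by auto
    then show "y \<in> {real (code b x) / real b ^ n..real (code b x) / real b ^ n + 1 / real b ^ n}"
      using val_prefix_bounds[where \<omega> = \<omega> and n = n, OF b \<omega>(2)] by (simp add: add_divide_distrib)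
  qed
  show bdd: "bounded (val b ` Z)" by (rule bounded_subset[OF bounded_closed_interval sub])
  have "diameter (val b ` Z) \<le>
      diameter {real (code b x) / real b ^ n..real (code b x) / real b ^ n + 1 / real b ^ n}"
    by (rule diameter_subset[OF sub bounded_closed_interval])
  also have "\<dots> = 1 / real b ^ n" using b by simp
  finally show "diameter (val b ` Z) \<le> 1 / real b ^ n" .
qed

text \<open>Three and not two, since cylinders are closed: the interval from (N + 1) / b^n to (N +
  2) / b^n also touches the cylinders N and N + 2. Distinct words have distinct codes, so it is
  enough to confine the codes to N, N + 1, N + 2.\<close>

lemma card_prefixes_meeting:
  assumes b: "b \<ge> 2" "D \<subseteq> {0..<b}" and U: "bounded U" "diameter U \<le> 1 / real b ^ n"
  defines "X \<equiv> {map \<omega> [0..<n] | \<omega>. (\<forall>k. \<omega> k \<in> D) \<and> val b \<omega> \<in> U}"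
  shows "finite X" "card X \<le> 3"
proof -
  have inj: "inj_on (code b) X"
  proof (rule inj_onI)
    fix x y assume "x \<in> X" "y \<in> X" "code b x = code b y"
    moreover then have "length x = length y" "set x \<subseteq> {..<b}" "set y \<subseteq> {..<b}"
      using b(2) by (auto simp: X_def subset_iff)
    ultimately show "x = y" by (intro code_inject)
  qed
  have fin: "finite (code b ` X) \<and> card (code b ` X) \<le> 3"
  proof (cases "X = {}")
    case False
    define N where "N = (LEAST k. k \<in> code b ` X)"
    have "\<exists>k. k \<in> code b ` X" using False by blast
    then have N: "N \<in> code b ` X" unfolding N_def by (rule LeastI_ex)
    have "code b ` X \<subseteq> {N..N + 2}"
    proof
      fix k assume k: "k \<in> code b ` X"
      then obtain \<omega> where w: "k = code b (map \<omega> [0..<n])" "\<And>k. \<omega> k \<in> D" "val b \<omega> \<in> U"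
        by (auto simp: X_def)
      obtain \<omega>' where w': "N = code b (map \<omega>' [0..<n])" "\<And>k. \<omega>' k \<in> D" "val b \<omega>' \<in> U"
        using N by (auto simp: X_def)
      have lt: "\<And>k. \<omega> k < b" "\<And>k. \<omega>' k < b" using w(2) w'(2) b(2) by (force simp: subset_iff)+
      have "dist (val b \<omega>) (val b \<omega>') \<le> diameter U"
        using diameter_bounded_bound[OF U(1) w(3) w'(3)] .
      then have "val b \<omega> \<le> val b \<omega>' + 1 / real b ^ n" using U(2) by (auto simp: dist_real_def)
      then have "real k / real b ^ n \<le> (real N + 1) / real b ^ n + 1 / real b ^ n"
        using val_prefix_bounds(1)[where \<omega> = \<omega> and n = n, OF b(1) lt(1)]
          val_prefix_bounds(2)[where \<omega> = \<omega>' and n = n, OF b(1) lt(2)] w(1) w'(1)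
        by simp
      also have "\<dots> = (real N + 2) / real b ^ n" by (simp add: add_divide_distrib[symmetric])
      finally have "real k \<le> real N + 2" using b(1) by (simp add: divide_le_cancel)
      moreover have "N \<le> k" unfolding N_def using k by (rule Least_le)
      ultimately show "k \<in> {N..N + 2}" by simp
    qed
    then show ?thesis using card_mono[of "{N..N + 2}" "code b ` X"] finite_subset by auto
  qed simp
  then show "finite X" using inj finite_imageD by blast
  show "card X \<le> 3" using fin card_image[OF inj] by simp
qed

section \<open>Limit sets of runs\<close>

text \<open>At most q^L exp (- s / 2) words of length L avoid the runs in \<open>T\<close>, where s
  is the sum of q^-l over \<open>T\<close>, and each cylinder weighs at most C q^-L. The powers of q
  cancel, and s can be made arbitrarily large. Avoiding all blocks of digits c is stronger than
  avoiding runs, so these words do cover the set.\<close>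

lemma hausdorff_pre_avoid_null:
  assumes b: "b \<ge> 2" "D \<subseteq> {0..<b}" "2 \<le> card D" "c \<in> D"
    and f: "dimension_function f" and C: "\<And>n. f (1 / real b ^ n) \<le> C / real (card D) ^ n"
    and div: "\<not> (\<lambda>k. 1 / real (card D) ^ l k) summable_on S" and \<delta>: "\<delta> > 0"
  shows "hausdorff_pre f \<delta> (val b ` {\<omega>. (\<forall>k. \<omega> k \<in> D) \<and>
    (\<forall>k\<in>S. N \<le> k \<longrightarrow> \<not> (\<forall>i\<in>{k..<k + l k}. \<omega> i = c))}) = 0"
proof -
  define X where "X = {\<omega>. (\<forall>k. \<omega> k \<in> D) \<and> (\<forall>k\<in>S. N \<le> k \<longrightarrow> \<not> (\<forall>i\<in>{k..<k + l k}. \<omega> i = c))}"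
  have D: "finite D" using b(2) finite_subset by auto
  have q: "real (card D) > 0" using b(3) by simp
  have fpos: "0 < f r" if "r > 0" for r using f that by (simp add: dimension_function_def)
  have "0 < f (1 / real b ^ 0)" using b by (intro fpos) auto
  then have C0: "C > 0" using C[of 0] by simp
  have "hausdorff_pre f \<delta> (val b ` X) \<le> 0 + ennreal e" if e: "e > 0" for e
  proof -
    \<comment> \<open>The exponent is half of this sum, so the target makes C exp (- s / 2) at most
      e. Levels are at least 1 because a run needs a preceding digit.\<close>
    obtain T where T: "finite T" "T \<subseteq> S" "\<forall>k\<in>T. max N 1 \<le> k"
        "2 * ln (C / e) \<le> (\<Sum>k\<in>T. 1 / real (card D) ^ l k)"
      using not_summable_on_imp_large_sums[OF _ div, of "max N 1" "2 * ln (C / e)"] by auto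
    obtain L1 where L1: "(1 / real b) ^ L1 < \<delta>"
      using real_arch_pow_inv[OF \<delta>, of "1 / real b"] b by auto
    \<comment> \<open>Long enough both for cylinders of diameter at most \<delta> and for all blocks
      of \<open>T\<close> to fit into the first L digits.\<close>
    define L where "L = L1 + (\<Sum>k\<in>T. k + l k)"
    have TL: "1 \<le> k \<and> k + l k \<le> L" if "k \<in> T" for k
      using T member_le_sum[OF that, of "\<lambda>k. k + l k"] that by (auto simp: L_def)
    have "1 / real b ^ L \<le> 1 / real b ^ L1"
      using b by (intro divide_left_mono power_increasing) (auto simp: L_def)
    then have L: "1 / real b ^ L \<le> \<delta>" using L1 by (simp add: power_divide)
    define J where "J = {x \<in> words D L. \<forall>j\<in>T. \<not> run c l j x}"
    have "hausdorff_pre f \<delta> (val b ` X) \<le> of_nat (card J) * ennreal (f (1 / real b ^ L))"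
    proof (rule hausdorff_pre_finite_cover[OF f])
      show "finite J" using finite_words[OF D] by (simp add: J_def)
      show "val b ` X \<subseteq> (\<Union>x\<in>J. val b ` {\<omega>. (\<forall>k. \<omega> k \<in> D) \<and> map \<omega> [0..<L] = x})"
      proof
        fix y assume "y \<in> val b ` X"
        then obtain \<omega> where \<omega>: "y = val b \<omega>" "\<omega> \<in> X" by auto
        have "map \<omega> [0..<L] \<in> words D L" using \<omega> by (auto simp: words_def X_def)
        moreover have "\<not> run c l j (map \<omega> [0..<L])" if "j \<in> T" for j
        proof
          assume r: "run c l j (map \<omega> [0..<L])"
          then have "\<forall>i\<in>{j..<j + l j}. \<omega> i = c"
            using TL[OF that] by (auto simp: run_def)
          moreover have "j \<in> S" "N \<le> j" using T that by auto
          ultimately show False using \<omega>(2) unfolding X_def by blast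
        qed
        ultimately have "map \<omega> [0..<L] \<in> J" by (simp add: J_def)
        then show "y \<in> (\<Union>x\<in>J. val b ` {\<omega>. (\<forall>k. \<omega> k \<in> D) \<and> map \<omega> [0..<L] = x})"
          using \<omega> by (auto simp: X_def)
      qed
      fix x assume "x \<in> J"
      have "(\<forall>k. \<omega> k < b) \<and> map \<omega> [0..<L] = x"
        if "\<omega> \<in> {\<omega>. (\<forall>k. \<omega> k \<in> D) \<and> map \<omega> [0..<L] = x}" for \<omega>
        using that b(2) by (force simp: subset_iff)
      from cylinder_diameter[where n = L, OF b(1) this]
      show "bounded (val b ` {\<omega>. (\<forall>k. \<omega> k \<in> D) \<and> map \<omega> [0..<L] = x})"
        "diameter (val b ` {\<omega>. (\<forall>k. \<omega> k \<in> D) \<and> map \<omega> [0..<L] = x}) \<le> 1 / real b ^ L"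
        by blast+
    qed (use b L in auto)
    also have "\<dots> = ennreal (real (card J) * f (1 / real b ^ L))"
      by (simp add: ennreal_of_nat_eq_real_of_nat ennreal_mult')
    also have "\<dots> \<le> ennreal e"
    proof (rule ennreal_leI)
      have "real (card J) * f (1 / real b ^ L) \<le> (real (card D) ^ L *
          exp (- (\<Sum>j\<in>T. 1 / (2 * real (card D) ^ l j)))) * (C / real (card D) ^ L)"
        using card_avoid_le[where l=l and c=c and L=L, OF D b(4,3) T(1) TL] C[of L] fpos[of "1 / real b ^ L"] b
        by (intro mult_mono) (auto simp: J_def less_imp_le)
      also have "\<dots> = C * exp (- (\<Sum>j\<in>T. 1 / (2 * real (card D) ^ l j)))"
        using q by simp
      also have "\<dots> \<le> C * exp (- ln (C / e))"
      proof -
        have "(\<Sum>j\<in>T. 1 / (2 * real (card D) ^ l j)) = (\<Sum>j\<in>T. 1 / real (card D) ^ l j) / 2"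
          by (simp add: sum_divide_distrib mult.commute)
        then show ?thesis using T(4) C0 by simp
      qed
      also have "\<dots> = e" using C0 e by (simp add: exp_minus)
      finally show "real (card J) * f (1 / real b ^ L) \<le> e" .
    qed
    finally show ?thesis by simp
  qed
  then have "hausdorff_pre f \<delta> (val b ` X) \<le> 0" by (rule ennreal_le_epsilon)
  then show ?thesis by (simp add: X_def)
qed

lemma ex_scale:
  fixes b d :: real
  assumes "b > 1" "0 < d" "d \<le> 1 / b ^ n"
  shows "\<exists>j\<ge>n. 1 / b ^ Suc j < d \<and> d \<le> 1 / b ^ j"
proof -
  define P where "P \<equiv> \<lambda>j. 1 / b ^ j < d"
  obtain N where "(1 / b) ^ N < d"
    using real_arch_pow_inv[OF assms(2), of "1 / b"] assms(1) by auto
  then have "P N" by (simp add: P_def power_divide)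
  define j where "j = (LEAST j. P j)"
  have j: "P j" unfolding j_def using \<open>P N\<close> by (rule LeastI)
  have "n < j"
  proof (rule ccontr)
    assume "\<not> n < j"
    then have "1 / b ^ n \<le> 1 / b ^ j"
      using assms(1) by (intro divide_left_mono power_increasing) auto
    then show False using j assms by (simp add: P_def)
  qed
  then obtain i where i: "j = Suc i" "n \<le> i" by (cases j) auto
  have "\<not> P i" using not_less_Least[of i P] i by (simp add: j_def)
  then show ?thesis using i j by (intro exI[of _ i]) (auto simp: P_def)
qed

text \<open>A set of diameter d with b^-(j+1) < d <= b^-j meets at most 3 cylinders of level j, and
  \<phi>(j) <= q \<phi>(j+1) <= q f(d) because F increases. A cover of total weight below F(n) / (48
  q) thus becomes one by words of weight below F(n) / 16 + \<eta>, which is less than F(n) / 8, and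
  some point of the limit set escapes it.\<close>

lemma hausdorff_pre_limit_ge:
  assumes b: "b \<ge> 2" "D \<subseteq> {0..<b}" "2 \<le> card D" "c \<in> D"
    and f: "dimension_function f"
    and F: "\<And>n. F n = f (1 / real b ^ n) * real (card D) ^ n" "incseq F" "\<And>B. \<exists>n. B < F n"
    and l: "\<And>k. k \<in> S \<Longrightarrow> 3 \<le> l k"
    and div: "\<not> (\<lambda>k. F (k + l k) / real (card D) ^ l k) summable_on S"
  shows "ennreal (F n / (48 * real (card D))) \<le> hausdorff_pre f (1 / real b ^ n)
    (val b ` {\<omega>. (\<forall>k. \<omega> k \<in> D) \<and> (\<forall>N. \<exists>k\<in>S. N \<le> k \<and> (\<forall>i\<in>{k..<k + l k}. \<omega> i = c))})"
proof (rule ccontr)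
  define \<Lambda> where "\<Lambda> = {\<omega>. (\<forall>k. \<omega> k \<in> D) \<and> (\<forall>N. \<exists>k\<in>S. N \<le> k \<and> (\<forall>i\<in>{k..<k + l k}. \<omega> i = c))}"
  define q where "q = real (card D)"
  define \<phi> where "\<phi> \<equiv> \<lambda>n. f (1 / real b ^ n)"
  have D: "finite D" using b(2) finite_subset by auto
  have q: "q \<ge> 2" using b(3) by (simp add: q_def)
  have fpos: "0 < f r" if "r > 0" for r using f that by (simp add: dimension_function_def)
  have fmono: "f r \<le> f s" if "0 < r" "r \<le> s" for r s
    using f that by (auto simp: dimension_function_def intro: mono_onD)
  have \<phi>0: "0 < \<phi> n" for n using b by (simp add: \<phi>_def fpos)
  have \<phi>F: "\<phi> n = F n / real (card D) ^ n" for n using b by (simp add: F(1) \<phi>_def)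
  have F0: "0 < F n" for n using \<phi>0[of n] q by (simp add: F(1) \<phi>_def q_def)
  have anti: "antimono \<phi>"
    unfolding \<phi>_def using b by (intro antimonoI fmono divide_left_mono power_increasing) auto
  have \<phi>q: "\<phi> j \<le> q * \<phi> (Suc j)" for j
  proof -
    have "F j / q ^ j \<le> F (Suc j) / q ^ j" using incseqD[OF F(2), of j "Suc j"] q by (intro divide_right_mono) auto
    then show ?thesis using q by (simp add: \<phi>F q_def)
  qed
  have \<phi>lim: "\<exists>j\<ge>n. \<phi> j \<le> \<epsilon>" if "\<epsilon> > 0" for \<epsilon>
  proof -
    have "((\<lambda>j. 1 / real b ^ j) \<longlongrightarrow> 0) sequentially"
      using b LIMSEQ_power_zero[of "1 / real b"] by (simp add: power_divide)
    then have "filterlim (\<lambda>j. 1 / real b ^ j) (at_right 0) sequentially"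
      using b by (auto simp: filterlim_at eventually_sequentially)
    then have "(\<lambda>j. f (1 / real b ^ j)) \<longlonglongrightarrow> 0"
      using f filterlim_compose[of f "nhds 0" "at_right 0"] by (simp add: dimension_function_def)
    then have "eventually (\<lambda>j. f (1 / real b ^ j) < \<epsilon>) sequentially"
      using that by (rule order_tendstoD)
    then obtain N where "\<And>j. j \<ge> N \<Longrightarrow> \<phi> j < \<epsilon>" by (auto simp: eventually_sequentially \<phi>_def)
    then show ?thesis by (intro exI[of _ "max n N"]) (auto intro: less_imp_le)
  qed
  assume "\<not> ?thesis"
  then have "hausdorff_pre f (1 / real b ^ n) (val b ` \<Lambda>) < ennreal (F n / (48 * q))"
    by (simp add: q_def \<Lambda>_def not_le)
  then obtain U where U: "val b ` \<Lambda> \<subseteq> (\<Union>i. U i)" "\<And>i. bounded (U i)" "\<And>i. diameter (U i) \<le> 1 / real b ^ n"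
      "(\<Sum>i::nat. ennreal (if diameter (U i) > 0 then f (diameter (U i)) else 0)) < ennreal (F n / (48 * q))"
    unfolding hausdorff_pre_def INF_less_iff by auto
  define w where "w \<equiv> \<lambda>i. if diameter (U i) > 0 then f (diameter (U i)) else 0"
  have w0: "0 \<le> w i" for i using fpos by (simp add: w_def less_imp_le)
  \<comment> \<open>Covering sets of diameter 0 weigh nothing, whereas the words replacing them have
    positive weight; \<eta> is the budget for these, shared out as \<eta> / 2^(i+1).\<close>
  define \<eta> where "\<eta> = F n / 32"
  have \<eta>: "\<eta> > 0" using F0 by (simp add: \<eta>_def)
  have "\<exists>j\<ge>n. diameter (U i) \<le> 1 / real b ^ j \<and> 3 * \<phi> j \<le> 3 * q * w i + \<eta> * (1 / 2) ^ Suc i" for i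
  proof (cases "diameter (U i) > 0")
    case True
    obtain j where j: "j \<ge> n" "1 / real b ^ Suc j < diameter (U i)" "diameter (U i) \<le> 1 / real b ^ j"
      using ex_scale[OF _ True U(3)] b by auto
    have "\<phi> j \<le> q * \<phi> (Suc j)" by (rule \<phi>q)
    also have "\<dots> \<le> q * w i"
      unfolding w_def \<phi>_def using True j q b by (auto intro!: mult_left_mono fmono)
    finally show ?thesis using j \<eta> by (intro exI[of _ j]) (auto intro!: add_increasing2)
  next
    case False
    then have "diameter (U i) \<le> 1 / real b ^ j" for j
      by (rule order_trans[OF leI]) auto
    moreover obtain j where "j \<ge> n" "\<phi> j \<le> \<eta> * (1 / 2) ^ Suc i / 3"
      using \<phi>lim[of "\<eta> * (1 / 2) ^ Suc i / 3"] \<eta> by auto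
    ultimately show ?thesis using w0[of i] q by (intro exI[of _ j]) (auto intro!: add_increasing)
  qed
  then obtain j where j: "\<And>i. n \<le> j i" "\<And>i. diameter (U i) \<le> 1 / real b ^ j i"
      "\<And>i. 3 * \<phi> (j i) \<le> 3 * q * w i + \<eta> * (1 / 2) ^ Suc i"
    by metis
  define V where "V \<equiv> \<lambda>i. {map \<omega> [0..<j i] | \<omega>. (\<forall>k. \<omega> k \<in> D) \<and> val b \<omega> \<in> U i}"
  have V: "finite (V i)" "card (V i) \<le> 3" for i
    using card_prefixes_meeting[OF b(1,2) U(2) j(2), of i] by (auto simp: V_def)
  have Vlen: "length v = j i" if "v \<in> V i" for v i using that by (auto simp: V_def)
  have "(\<Sum>i. \<Sum>v\<in>V i. ennreal (\<phi> (length v))) \<le>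
      (\<Sum>i. ennreal (3 * q) * ennreal (w i) + ennreal (\<eta> * (1 / 2) ^ Suc i))"
  proof (intro suminf_le allI)
    fix i
    have "(\<Sum>v\<in>V i. ennreal (\<phi> (length v))) = (\<Sum>v\<in>V i. ennreal (\<phi> (j i)))"
      using Vlen by (intro sum.cong) auto
    also have "\<dots> = ennreal (real (card (V i)) * \<phi> (j i))"
      by (simp add: ennreal_of_nat_eq_real_of_nat ennreal_mult')
    also have "\<dots> \<le> ennreal (3 * q * w i + \<eta> * (1 / 2) ^ Suc i)"
    proof (rule ennreal_leI)
      have "real (card (V i)) * \<phi> (j i) \<le> 3 * \<phi> (j i)"
        using V(2)[of i] \<phi>0 by (intro mult_right_mono) (auto simp: less_imp_le)
      then show "real (card (V i)) * \<phi> (j i) \<le> 3 * q * w i + \<eta> * (1 / 2) ^ Suc i"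
        using j(3)[of i] by simp
    qed
    also have "\<dots> = ennreal (3 * q * w i) + ennreal (\<eta> * (1 / 2) ^ Suc i)"
      using w0[of i] q \<eta> by (intro ennreal_plus) auto
    also have "ennreal (3 * q * w i) = ennreal (3 * q) * ennreal (w i)"
      using q by (intro ennreal_mult') simp
    finally show "(\<Sum>v\<in>V i. ennreal (\<phi> (length v))) \<le> ennreal (3 * q) * ennreal (w i) + ennreal (\<eta> * (1 / 2) ^ Suc i)" .
  qed auto
  also have "\<dots> = ennreal (3 * q) * (\<Sum>i. ennreal (w i)) + (\<Sum>i. ennreal (\<eta> * (1 / 2) ^ Suc i))"
    by (subst suminf_add[symmetric]) auto
  also have "(\<Sum>i. ennreal (\<eta> * (1 / 2) ^ Suc i)) = ennreal \<eta>"
  proof (rule suminf_ennreal_eq)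
    show "(\<lambda>i. \<eta> * (1 / 2) ^ Suc i) sums \<eta>"
      using sums_mult[OF power_half_series, of \<eta>] by simp
  qed (use \<eta> in auto)
  also have "ennreal (3 * q) * (\<Sum>i. ennreal (w i)) + ennreal \<eta> \<le>
      ennreal (3 * q) * ennreal (F n / (48 * q)) + ennreal \<eta>"
    using U(4) by (intro add_right_mono mult_left_mono) (auto simp: w_def)
  also have "ennreal (3 * q) * ennreal (F n / (48 * q)) = ennreal (F n / 16)"
    using q by (subst ennreal_mult'[symmetric]) auto
  also have "ennreal (F n / 16) + ennreal \<eta> = ennreal (F n * 3 / 32)"
    using F0[of n] by (subst ennreal_plus[symmetric]) (auto simp: \<eta>_def)
  also have "\<dots> < ennreal (F n / 8)" using F0[of n] by (intro ennreal_lessI) auto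
  finally have small: "(\<Sum>i. \<Sum>v\<in>V i. ennreal (\<phi> (length v))) < ennreal (F n / 8)" .
  have "\<exists>\<omega>. (\<forall>k. \<omega> k \<in> D) \<and> (\<forall>N. \<exists>k\<in>S. N \<le> k \<and> (\<forall>i\<in>{k..<k + l k}. \<omega> i = c)) \<and>
    (\<forall>i. \<forall>v\<in>V i. v \<noteq> map \<omega> [0..<length v])"
    by (rule ex_limit_point_avoiding[OF D b(4,3) F0 F(2,3) \<phi>F anti l div V(1) _ small])
      (use j(1) Vlen in auto)
  then obtain \<omega> where \<omega>: "\<forall>k. \<omega> k \<in> D" "\<forall>i. \<forall>v\<in>V i. v \<noteq> map \<omega> [0..<length v]"
      "\<forall>N. \<exists>k\<in>S. N \<le> k \<and> (\<forall>i\<in>{k..<k + l k}. \<omega> i = c)"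
    by (elim exE conjE)
  have "\<omega> \<in> \<Lambda>" unfolding \<Lambda>_def using \<omega>(1,3) by (intro CollectI conjI)
  then obtain i where i: "val b \<omega> \<in> U i" using U(1) by blast
  have "map \<omega> [0..<j i] \<in> V i"
    unfolding V_def by (intro CollectI exI[of _ \<omega>] conjI refl \<omega>(1) i)
  then have "map \<omega> [0..<j i] \<noteq> map \<omega> [0..<length (map \<omega> [0..<j i])]"
    by (intro bspec[OF spec[OF \<omega>(2)]])
  then show False by simp
qed

section \<open>Exponents, endpoints and approximation sets\<close>

lemma powr_log_ratio:
  assumes "2 \<le> b" "1 \<le> q" "\<gamma> = ln (real q) / ln (real b)"
  shows "real b powr \<gamma> = real q" "0 \<le> \<gamma>" "real b powr (x * \<gamma>) = real q powr x"
proof -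
  show 1: "real b powr \<gamma> = real q" using assms by (simp add: powr_def)
  show "0 \<le> \<gamma>" using assms by simp
  show "real b powr (x * \<gamma>) = real q powr x"
    using 1 by (metis mult.commute powr_powr)
qed

text \<open>Since b^\<gamma> = q, F(n) is the value of r^-\<gamma> f(r) at r = b^-n, and r decreases
  as n grows. A nondecreasing quotient gives F <= F 0; a nonincreasing one makes F increase, and if
  it stays bounded the first alternative applies again.\<close>

lemma growth_dichotomy:
  fixes f :: "real \<Rightarrow> real" and q :: nat
  assumes b: "2 \<le> b" "1 \<le> q" and \<gamma>: "\<gamma> = ln (real q) / ln (real b)"
    and f_mono: "mono_on {0<..} (\<lambda>r. r powr (-\<gamma>) * f r) \<or> antimono_on {0<..} (\<lambda>r. r powr (-\<gamma>) * f r)"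
  defines "F \<equiv> \<lambda>n. f (1 / real b ^ n) * real q ^ n"
  shows "(\<exists>C. \<forall>n. F n \<le> C) \<or> (incseq F \<and> (\<forall>B. \<exists>n. B < F n))"
proof -
  have F: "F n = (1 / real b ^ n) powr (-\<gamma>) * f (1 / real b ^ n)" for n
  proof -
    have "(1 / real b ^ n) powr (-\<gamma>) = (real b ^ n) powr \<gamma>"
      using b by (simp add: powr_divide powr_minus field_simps)
    also have "\<dots> = real b powr (real n * \<gamma>)"
      using b by (simp add: powr_powr powr_realpow[symmetric])
    also have "\<dots> = real q ^ n"
      using b powr_log_ratio(3)[OF b \<gamma>] by (simp add: powr_realpow)
    finally show ?thesis by (simp add: F_def)
  qed
  have le: "1 / real b ^ j \<le> 1 / real b ^ i" if "i \<le> j" for i j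
    using b that by (intro divide_left_mono power_increasing) auto
  show ?thesis
  proof (cases "mono_on {0<..} (\<lambda>r. r powr (-\<gamma>) * f r)")
    case True
    have "F n \<le> F 0" for n
      unfolding F by (rule monotone_onD[OF True]) (use le[of 0 n] b in auto)
    then show ?thesis by blast
  next
    case False
    then have anti: "antimono_on {0<..} (\<lambda>r. r powr (-\<gamma>) * f r)" using f_mono by simp
    have "incseq F"
    proof (rule incseq_SucI)
      fix n
      show "F n \<le> F (Suc n)"
        unfolding F by (rule monotone_onD[OF anti]) (use le[of n "Suc n"] b in auto)
    qed
    then show ?thesis by (meson not_le)
  qed
qed

section \<open>Divisibility between powers of b and t through prime exponents\<close>

lemma alpha_bounds:
  assumes "q \<in> prime_factors b"
  shows "alpha1 b t \<le> real (multiplicity q t) / real (multiplicity q b)"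
    "real (multiplicity q t) / real (multiplicity q b) \<le> alpha2 b t"
  unfolding alpha1_def alpha2_def using assms by (auto intro!: Min_le Max_ge)

lemma multiplicity_prime_factor_pos:
  "q \<in> prime_factors (b :: nat) \<Longrightarrow> 0 < multiplicity q b"
  by (simp add: prime_factors_multiplicity)

lemma ex_prime_factor:
  assumes "(b :: nat) \<ge> 2"
  obtains q where "q \<in> prime_factors b"
proof -
  obtain q where "prime q" "q dvd b" using prime_factor_nat[of b] assms by auto
  then show ?thesis using that[of q] assms by (simp add: in_prime_factors_iff)
qed

text \<open>Every prime divisor of b divides t, so all the quotients are positive. Positivity makes
  the levels floor (i \<alpha>1) tend to infinity with i.\<close>

lemma alpha1_pos:
  assumes "b \<ge> 2" "prime_factors t = prime_factors b"
  shows "0 < alpha1 b t"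
proof -
  have ne: "prime_factors b \<noteq> {}" using ex_prime_factor[OF assms(1)] by blast
  have "real (multiplicity q t) / real (multiplicity q b) > 0" if "q \<in> prime_factors b" for q
    using multiplicity_prime_factor_pos that assms(2) by (metis divide_pos_pos of_nat_0_less_iff)
  then show ?thesis unfolding alpha1_def using ne by (subst Min_gr_iff) auto
qed

lemma alpha2_nonneg:
  assumes "b \<ge> 2"
  shows "0 \<le> alpha2 b t"
proof -
  obtain q where "q \<in> prime_factors b" using ex_prime_factor[OF assms] .
  then show ?thesis using alpha_bounds(2)[of q b t] by (meson divide_nonneg_nonneg of_nat_0_le_iff order_trans)
qed

lemma power_dvd_power_of_multiplicity:
  fixes b t :: nat
  assumes "b > 0" "t > 0"
    and "\<And>q. q \<in> prime_factors b \<Longrightarrow> k * multiplicity q b \<le> i * multiplicity q t"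
  shows "b ^ k dvd t ^ i"
proof (rule multiplicity_le_imp_dvd)
  fix q :: nat assume q: "prime q"
  show "multiplicity q (b ^ k) \<le> multiplicity q (t ^ i)"
  proof (cases "q \<in> prime_factors b")
    case True
    then show ?thesis using assms q by (simp add: prime_elem_multiplicity_power_distrib)
  next
    case False
    then have "multiplicity q b = 0"
      using q assms by (simp add: in_prime_factors_iff not_dvd_imp_multiplicity_0)
    then show ?thesis using assms q by (simp add: prime_elem_multiplicity_power_distrib)
  qed
qed (use assms in auto)

text \<open>The inequality k <= i \<alpha>1 amounts to k v_q(b) <= i v_q(t) at every prime divisor q
  of b, so floor (i \<alpha>1) is the largest admissible k.\<close>

lemma power_dvd_of_le_alpha1:
  assumes "b \<ge> 2" "t \<ge> 2" "real k \<le> real i * alpha1 b t"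
  shows "b ^ k dvd t ^ i"
proof (rule power_dvd_power_of_multiplicity)
  fix q assume q: "q \<in> prime_factors b"
  have pos: "0 < multiplicity q b" by (rule multiplicity_prime_factor_pos[OF q])
  have "real k \<le> real i * (real (multiplicity q t) / real (multiplicity q b))"
    using assms(3) alpha_bounds(1)[OF q, of t] by (meson mult_left_mono of_nat_0_le_iff order_trans)
  then have "real (k * multiplicity q b) \<le> real (i * multiplicity q t)"
    using pos by (simp add: field_simps)
  then show "k * multiplicity q b \<le> i * multiplicity q t" by (simp only: of_nat_le_iff)
qed (use assms in auto)

lemma power_dvd_of_ge_alpha2:
  assumes "b \<ge> 2" "t \<ge> 2" "prime_factors t = prime_factors b" "real i * alpha2 b t \<le> real k"
  shows "t ^ i dvd b ^ k"
proof (rule power_dvd_power_of_multiplicity)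
  fix q assume "q \<in> prime_factors t"
  then have q: "q \<in> prime_factors b" using assms by simp
  have pos: "0 < multiplicity q b" by (rule multiplicity_prime_factor_pos[OF q])
  have "real i * (real (multiplicity q t) / real (multiplicity q b)) \<le> real k"
    using assms(4) alpha_bounds(2)[OF q, of t] by (meson mult_left_mono of_nat_0_le_iff order_trans)
  then have "real (i * multiplicity q t) \<le> real (k * multiplicity q b)"
    using pos by (simp add: field_simps)
  then show "i * multiplicity q t \<le> k * multiplicity q b" by (simp only: of_nat_le_iff)
qed (use assms in auto)

text \<open>If neither m nor b - 1 - m were a digit, m + 1 would qualify too. An element of
  \<open>D\<close> bounds the candidates, without which \<open>GREATEST\<close> would carry no
  information.\<close>

lemma m_of_props:
  assumes "D \<subseteq> {0..<b}" "D \<noteq> {}"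
  shows "D \<subseteq> {m_of b D..b - 1 - m_of b D}" "m_of b D \<in> D \<or> b - 1 - m_of b D \<in> D" "m_of b D \<le> b - 1"
proof -
  define P where "P \<equiv> \<lambda>m. D \<subseteq> {m..b - 1 - m}"
  have P0: "P 0" using assms by (auto simp: P_def)
  have bd: "m \<le> b" if "P m" for m
  proof -
    obtain d where "d \<in> D" using assms by auto
    then have "m \<le> d" "d < b" using that assms by (auto simp: P_def)
    then show ?thesis by simp
  qed
  have m: "m_of b D = Greatest P" by (simp add: m_of_def P_def)
  have Pm: "P (m_of b D)" unfolding m by (rule GreatestI_nat[of P 0 b, OF P0 bd])
  then show "D \<subseteq> {m_of b D..b - 1 - m_of b D}" by (simp add: P_def)
  then show "m_of b D \<le> b - 1" using assms(2) by fastforce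
  show "m_of b D \<in> D \<or> b - 1 - m_of b D \<in> D"
  proof (rule ccontr)
    assume *: "\<not> ?thesis"
    have "P (Suc (m_of b D))"
      unfolding P_def
    proof
      fix d assume d: "d \<in> D"
      then have "m_of b D \<le> d" "d \<le> b - 1 - m_of b D" using Pm by (auto simp: P_def)
      moreover have "d \<noteq> m_of b D" "d \<noteq> b - 1 - m_of b D" using * d by auto
      ultimately show "d \<in> {Suc (m_of b D)..b - 1 - Suc (m_of b D)}" by auto
    qed
    then have "Suc (m_of b D) \<le> Greatest P" by (intro Greatest_le_nat[of P _ b] bd)
    then show False using m by simp
  qed
qed

text \<open>The constant digit c expands to m / (b - 1) or to 1 - m / (b - 1), so a long block of digits c
  puts the tail close to one of these two values, at distance m / (b - 1) from an integer.\<close>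
lemma near_endpoint:
  assumes b: "b \<ge> 2" "\<And>k. \<omega> k < b" and m: "m \<le> b - 1" and c: "c = m \<or> c = b - 1 - m"
    and const: "\<And>i. i \<in> {k..<k + l} \<Longrightarrow> \<omega> i = c"
  shows "\<exists>p::nat. \<bar>val b \<omega> - real p / real b ^ k\<bar>
    \<le> real m / ((real b - 1) * real b ^ k) + 1 / real b ^ (k + l)"
proof -
  define N where "N = code b (map \<omega> [0..<k])"
  define \<sigma> where "\<sigma> \<equiv> \<lambda>j. \<omega> (k + j)"
  have cb: "c < b" using c m b by auto
  have \<sigma>b: "\<And>j. \<sigma> j < b" using b by (simp add: \<sigma>_def)
  have "map \<sigma> [0..<l] = map (\<lambda>_. c) [0..<l]" using const by (auto simp: \<sigma>_def)
  \<comment> \<open>z and z' are the values of the tails after the l common digits, so the two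
    sequences have values within b^-l of each other.\<close>
  then obtain z z' where z: "val b \<sigma> = (real (code b (map (\<lambda>_. c) [0..<l])) + z) / real b ^ l"
      "val b (\<lambda>_. c) = (real (code b (map (\<lambda>_. c) [0..<l])) + z') / real b ^ l"
      "0 \<le> z" "z \<le> 1" "0 \<le> z'" "z' \<le> 1"
    using val_split[where \<omega> = \<sigma> and n = l, OF b(1) \<sigma>b]
      val_split[where \<omega> = "\<lambda>_. c" and n = l, OF b(1) cb]
      val_range[where \<omega> = "\<lambda>j. \<sigma> (l + j)", OF b(1) \<sigma>b]
      val_range[where \<omega> = "\<lambda>_. c", OF b(1) cb] by metis
  have "\<bar>val b \<sigma> - val b (\<lambda>_. c)\<bar> = \<bar>z - z'\<bar> / real b ^ l"
    unfolding z(1,2) using b(1) by (simp add: diff_divide_distrib[symmetric])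
  also have "\<dots> \<le> 1 / real b ^ l" using z(3-6) by (intro divide_right_mono) auto
  finally have 1: "\<bar>val b \<sigma> - real c / (real b - 1)\<bar> \<le> 1 / real b ^ l"
    using sums_unique[OF digit_series[OF b(1), of c]] by (simp add: val_def)
  have v: "val b \<omega> = (real N + val b \<sigma>) / real b ^ k"
    using val_split[where \<omega> = \<omega> and n = k, OF b] by (simp add: N_def \<sigma>_def)
  have scale: "\<bar>val b \<omega> - real p / real b ^ k\<bar> \<le> real m / ((real b - 1) * real b ^ k) + 1 / real b ^ (k + l)"
    if "\<bar>real N + val b \<sigma> - real p\<bar> \<le> real m / (real b - 1) + 1 / real b ^ l" for p :: nat
  proof -
    have "\<bar>val b \<omega> - real p / real b ^ k\<bar> = \<bar>real N + val b \<sigma> - real p\<bar> / real b ^ k"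
      unfolding v by (simp add: diff_divide_distrib[symmetric])
    also have "\<dots> \<le> (real m / (real b - 1) + 1 / real b ^ l) / real b ^ k"
      using that by (intro divide_right_mono) auto
    finally show ?thesis by (simp add: add_divide_distrib power_add mult.commute)
  qed
  from val_range[where \<omega> = \<sigma>, OF b(1) \<sigma>b] have r: "0 \<le> val b \<sigma>" "val b \<sigma> \<le> 1" .
  from c show ?thesis
  proof
    assume "c = m"
    then show ?thesis using 1 r by (intro exI[of _ N] scale) auto
  next
    assume "c = b - 1 - m"
    then have "real c / (real b - 1) = 1 - real m / (real b - 1)"
      using m b(1) by (simp add: of_nat_diff field_simps)
    \<comment> \<open>The tail is near 1 - m / (b - 1), so the right end of the cylinder is the grid
      point to use.\<close>
    then show ?thesis using 1 r by (intro exI[of _ "N + 1"] scale) auto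
  qed
qed

section \<open>The approximation set, indexed by the distinct values of the sequence\<close>

lemma finite_index_le:
  assumes a_mono: "\<forall>n\<ge>1. \<forall>n'\<ge>n. a n \<le> a n'" and a_unbdd: "\<forall>K::nat. \<exists>n\<ge>1. a n > K"
  shows "finite {n. n \<ge> (1::nat) \<and> a n \<le> i}"
proof -
  obtain n1 where n1: "n1 \<ge> 1" "a n1 > i" using a_unbdd by blast
  have "{n. n \<ge> 1 \<and> a n \<le> i} \<subseteq> {..<n1}"
    using n1 a_mono by (auto simp: not_less[symmetric]) (metis le_less_trans not_le)
  then show ?thesis using finite_subset by blast
qed

text \<open>A nondecreasing unbounded sequence takes each value finitely often, so the maximum in
  \<open>psiA\<close> ranges over a finite set and is attained.\<close>

lemma psiA_props:
  assumes a_mono: "\<forall>n\<ge>1. \<forall>n'\<ge>n. a n \<le> a n'" and a_unbdd: "\<forall>K::nat. \<exists>n\<ge>1. a n > K"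
  shows "i \<in> I_set a \<Longrightarrow> \<exists>n\<ge>1. a n = i \<and> \<psi> n = psiA a \<psi> i"
    "n \<ge> 1 \<Longrightarrow> \<psi> n \<le> psiA a \<psi> (a n)"
proof -
  have fin: "finite {\<psi> n |n. n \<ge> 1 \<and> a n = i}" for i
  proof -
    have "finite {n. n \<ge> 1 \<and> a n = i}"
      by (rule finite_subset[OF _ finite_index_le[OF assms, of i]]) auto
    then have "finite (\<psi> ` {n. n \<ge> 1 \<and> a n = i})" by (rule finite_imageI)
    then show ?thesis by (simp add: image_def setcompr_eq_image)
  qed
  show "\<exists>n\<ge>1. a n = i \<and> \<psi> n = psiA a \<psi> i" if "i \<in> I_set a"
    using Max_in[OF fin[of i]] that unfolding psiA_def I_set_def by auto
  show "\<psi> n \<le> psiA a \<psi> (a n)" if "n \<ge> 1"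
    using Max_ge[OF fin[of "a n"]] that unfolding psiA_def by auto
qed

text \<open>For a given n only finitely many p are near x, and only finitely many n have
  \<open>a n\<close> below a given bound. Infinitely many pairs (p, n) therefore mean infinitely
  many values i of the sequence, and for each i the best radius is
  \<open>psiA a \<psi> i\<close>.\<close>

lemma W_set_iff:
  assumes a_mono: "\<forall>n\<ge>1. \<forall>n'\<ge>n. a n \<le> a n'" and a_unbdd: "\<forall>K::nat. \<exists>n\<ge>1. a n > K"
    and t: "t \<ge> 2"
  shows "x \<in> W_set t a \<psi> \<longleftrightarrow> 0 \<le> x \<and> x \<le> 1 \<and>
    (\<forall>i0. \<exists>i\<ge>i0. i \<in> I_set a \<and> (\<exists>p::nat. \<bar>x - real p / real t ^ i\<bar> < psiA a \<psi> i))"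
    (is "_ \<longleftrightarrow> _ \<and> _ \<and> ?R")
proof -
  define Z where "Z = {(p::nat, n). n \<ge> 1 \<and> \<bar>x - real p / real t ^ a n\<bar> < \<psi> n}"
  have "infinite Z \<longleftrightarrow> ?R"
  proof
    assume inf: "infinite Z"
    show ?R
    proof
      fix i0
      \<comment> \<open>A finite superset, up to swapping the components, of the pairs in
        \<open>Z\<close> with \<open>a n\<close> at most i0; a pair of \<open>Z\<close> outside it
        has a larger value.\<close>
      define Z0 where "Z0 = (SIGMA n:{n. n \<ge> 1 \<and> a n \<le> i0}. {p::nat. real p < (\<bar>x\<bar> + \<psi> n) * real t ^ a n})"
      have "finite {p::nat. real p < y}" for y :: real
        by (rule finite_subset[of _ "{..nat \<lceil>y\<rceil>}"]) (auto, linarith)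
      then have "finite Z0"
        unfolding Z0_def using finite_index_le[OF a_mono a_unbdd] by (intro finite_SigmaI) auto
      then have "finite (prod.swap ` Z0)" by simp
      then obtain p n where pn: "(p, n) \<in> Z" "(p, n) \<notin> prod.swap ` Z0"
        using inf by (metis finite_subset subrelI)
      have "real p / real t ^ a n < \<bar>x\<bar> + \<psi> n" using pn(1) by (auto simp: Z_def)
      then have "real p < (\<bar>x\<bar> + \<psi> n) * real t ^ a n" using t by (simp add: field_simps)
      then have "\<not> a n \<le> i0" using pn by (force simp: Z_def Z0_def)
      then show "\<exists>i\<ge>i0. i \<in> I_set a \<and> (\<exists>p::nat. \<bar>x - real p / real t ^ i\<bar> < psiA a \<psi> i)"
        using pn(1) psiA_props(2)[OF a_mono a_unbdd, of n \<psi>]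
        by (intro exI[of _ "a n"] conjI exI[of _ p]) (auto simp: Z_def I_set_def)
    qed
  next
    assume R: ?R
    show "infinite Z"
    proof
      assume "finite Z"
      then have "finite ((\<lambda>(p, n). a n) ` Z)" by simp
      then obtain B where B: "\<And>i. i \<in> (\<lambda>(p, n). a n) ` Z \<Longrightarrow> i \<le> B"
        by (meson finite_nat_set_iff_bounded_le)
      obtain i p where i: "i \<ge> Suc B" "i \<in> I_set a" "\<bar>x - real p / real t ^ i\<bar> < psiA a \<psi> i"
        using R by blast
      obtain n where n: "n \<ge> 1" "a n = i" "\<psi> n = psiA a \<psi> i"
        using psiA_props(1)[OF a_mono a_unbdd i(2)] by blast
      have "(p, n) \<in> Z" using n i by (simp add: Z_def)
      then have "a n \<le> B" using B by force
      then show False using n i by simp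
    qed
  qed
  then show ?thesis unfolding W_set_def Z_def by auto
qed

section \<open>The convergence part\<close>

lemma hausdorff_measure_eq_0I:
  assumes "\<And>\<delta>. \<delta> > 0 \<Longrightarrow> hausdorff_pre f \<delta> X = 0"
  shows "hausdorff_measure f X = 0"
proof -
  have "hausdorff_measure f X \<le> 0"
    unfolding hausdorff_measure_def using assms by (intro SUP_least) simp
  then show ?thesis by simp
qed

text \<open>Tail digits between m and b - 1 - m keep x at distance at least m / ((b - 1) b^k) from
  both ends of its cylinder. A grid point left of the cylinder is no closer than the left end, and
  likewise on the right, so only the two ends matter; the boolean index chooses between them. If
  \<rho> <= 0, no point is close enough and X is empty.\<close>

lemma hausdorff_pre_near_rationals_le:
  assumes b: "b \<ge> 2" "D \<subseteq> {0..<b}" and f: "dimension_function f"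
    and m: "D \<subseteq> {m..b - 1 - m}" "m \<le> b - 1"
    and \<rho>: "\<rho> = \<psi> - real m / ((real b - 1) * real b ^ k)" "\<rho> \<le> \<delta>" and \<delta>: "\<delta> > 0"
    and X: "\<And>x. x \<in> X \<Longrightarrow> x \<in> cantor_set b D \<and> (\<exists>p::nat. \<bar>x - real p / real b ^ k\<bar> < \<psi>)"
  shows "hausdorff_pre f \<delta> X \<le> (if \<rho> > 0 then ennreal (2 * real (card D) ^ k * f \<rho>) else 0)"
proof -
  define m' where "m' = real m / ((real b - 1) * real b ^ k)"
  define U where "U \<equiv> \<lambda>(w, s). if s then {real (code b w) / real b ^ k + m'..real (code b w) / real b ^ k + m' + \<rho>}
    else {(real (code b w) + 1) / real b ^ k - m' - \<rho>..(real (code b w) + 1) / real b ^ k - m'}"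
  have D: "finite D" using b(2) finite_subset by auto
  have cover: "\<rho> > 0 \<and> x \<in> (\<Union>j\<in>words D k \<times> UNIV. U j)" if x: "x \<in> X" for x
  proof -
    obtain \<omega> where \<omega>: "x = val b \<omega>" "\<And>i. \<omega> i \<in> D"
      using X[OF x] cantor_set_eq[OF b] by auto
    obtain p :: nat where p: "\<bar>x - real p / real b ^ k\<bar> < \<psi>" using X[OF x] by auto
    have lt: "\<And>i. \<omega> i < b" using \<omega>(2) b(2) by (force simp: subset_iff)
    define N where "N = code b (map \<omega> [0..<k])"
    define y where "y = val b (\<lambda>i. \<omega> (k + i))"
    have v: "x = real N / real b ^ k + y / real b ^ k"
      using val_split[where \<omega> = \<omega> and n = k, OF b(1) lt] \<omega>(1) by (simp add: N_def y_def add_divide_distrib)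
    have mem: "map \<omega> [0..<k] \<in> words D k" using \<omega> by (auto simp: words_def)
    have "m \<le> \<omega> (k + i)" "\<omega> (k + i) \<le> b - 1 - m" for i using \<omega>(2)[of "k + i"] m(1) by auto
    then have y: "real m / (real b - 1) \<le> y" "y \<le> real (b - 1 - m) / (real b - 1)"
      using val_bounds[of b m "\<lambda>i. \<omega> (k + i)" "b - 1 - m"] b(1) by (auto simp: y_def)
    have "real (b - 1 - m) / (real b - 1) = 1 - real m / (real b - 1)"
      using m(2) b(1) by (simp add: of_nat_diff field_simps)
    then have "y / real b ^ k \<le> (1 - real m / (real b - 1)) / real b ^ k"
      using y(2) by (intro divide_right_mono) auto
    then have y2: "y / real b ^ k \<le> 1 / real b ^ k - m'" by (simp add: m'_def diff_divide_distrib)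
    have "real m / (real b - 1) / real b ^ k \<le> y / real b ^ k"
      using y(1) by (intro divide_right_mono) auto
    then have y1: "m' \<le> y / real b ^ k" by (simp add: m'_def)
    show ?thesis
    proof (cases "p \<le> N")
      case True
      then have "real p / real b ^ k \<le> real N / real b ^ k" by (intro divide_right_mono) auto
      then have *: "y / real b ^ k < m' + \<rho>" using p v y1 \<rho>(1) by (simp add: m'_def)
      then have "x \<in> U (map \<omega> [0..<k], True)" using v y1 by (simp add: U_def N_def)
      moreover have "0 < \<rho>" using * y1 by simp
      ultimately show ?thesis using mem by (intro conjI UN_I[of "(map \<omega> [0..<k], True)"]) auto
    next
      case False
      then have "(real N + 1) / real b ^ k \<le> real p / real b ^ k" by (intro divide_right_mono) auto
      then have *: "1 / real b ^ k - y / real b ^ k < m' + \<rho>"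
        using p v y2 \<rho>(1) by (simp add: m'_def add_divide_distrib)
      then have "x \<in> U (map \<omega> [0..<k], False)" using v y2 by (simp add: U_def N_def add_divide_distrib)
      moreover have "0 < \<rho>" using * y2 by simp
      ultimately show ?thesis using mem by (intro conjI UN_I[of "(map \<omega> [0..<k], False)"]) auto
    qed
  qed
  show ?thesis
  proof (cases "\<rho> > 0")
    case True
    have "hausdorff_pre f \<delta> X \<le> of_nat (card (words D k \<times> (UNIV :: bool set))) * ennreal (f \<rho>)"
    proof (rule hausdorff_pre_finite_cover[OF f, where U = U])
      show "X \<subseteq> (\<Union>j\<in>words D k \<times> UNIV. U j)" using cover by blast
      fix j assume "j \<in> words D k \<times> (UNIV :: bool set)"
      show "bounded (U j)" by (cases j) (auto simp: U_def)
      show "diameter (U j) \<le> \<rho>" using True by (cases j) (auto simp: U_def)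
    qed (use True \<rho> finite_words[OF D] in auto)
    also have "\<dots> = ennreal (real (card (words D k \<times> (UNIV :: bool set)))) * ennreal (f \<rho>)"
      by (simp add: ennreal_of_nat_eq_real_of_nat)
    also have "\<dots> = ennreal (2 * real (card D) ^ k * f \<rho>)"
      by (subst ennreal_mult'[symmetric])
        (simp_all add: card_cartesian_product card_words[OF D] mult.commute)
    finally show ?thesis using True by simp
  next
    case False
    then have "X = {}" using cover by blast
    then show ?thesis using False hausdorff_pre_empty[of \<delta> f] \<delta> by simp
  qed
qed

lemma convergence_part:
  fixes \<psi> :: "nat \<Rightarrow> real"
  assumes b: "b \<ge> 2" "D \<subseteq> {0..<b}" "2 \<le> card D"
    and \<gamma>: "\<gamma> = ln (real (card D)) / ln (real b)"
    and m: "D \<subseteq> {m..b - 1 - m}" "m \<le> b - 1"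
    and t: "t \<ge> 2" "prime_factors t = prime_factors b"
    and a: "\<forall>n\<ge>1. \<forall>n'\<ge>n. a n \<le> a n'" "\<forall>K::nat. \<exists>n\<ge>1. a n > K"
    and f: "dimension_function f"
  defines "\<alpha> \<equiv> alpha2 b t"
  defines "\<rho> \<equiv> \<lambda>i. psiA a \<psi> i - real m / ((real b - 1) * real b ^ nat \<lceil>real i * \<alpha>\<rceil>)"
  assumes summ: "summable (\<lambda>i. if i \<in> I_set a \<and> 0 < \<rho> i
      then f (\<rho> i) * real b powr (real i * \<alpha> * \<gamma>) else 0)"
  shows "hausdorff_measure f (W_set t a \<psi> \<inter> cantor_set b D) = 0"
proof (rule hausdorff_measure_eq_0I)
  fix \<delta> :: real assume \<delta>: "\<delta> > 0"
  define q where "q = card D"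
  define h where "h \<equiv> \<lambda>i. if i \<in> I_set a \<and> 0 < \<rho> i
      then f (\<rho> i) * real b powr (real i * \<alpha> * \<gamma>) else 0"
  define K where "K \<equiv> \<lambda>i::nat. nat \<lceil>real i * \<alpha>\<rceil>"
  define X where "X \<equiv> \<lambda>i. if i \<in> I_set a then
    {x \<in> cantor_set b D. \<exists>p::nat. \<bar>x - real p / real t ^ i\<bar> < psiA a \<psi> i} else {}"
  have q: "2 \<le> real q" using b by (simp add: q_def)
  have \<alpha>: "0 \<le> \<alpha>" unfolding \<alpha>_def by (rule alpha2_nonneg[OF b(1)])
  have fpos: "0 < f r" if "r > 0" for r using f that by (simp add: dimension_function_def)
  have powr_q: "real b powr (x * \<gamma>) = real q powr x" for x
    using powr_log_ratio(3)[OF b(1) _ \<gamma>] b(3) by (simp add: q_def)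
  have h0: "0 \<le> h i" for i using fpos by (auto simp: h_def less_imp_le)
  have summ: "summable h" using summ by (simp add: h_def)
  \<comment> \<open>The terms tend to 0. When \<rho> i > 0, the factor q^(i \<alpha>) >= 1 gives f
    (\<rho> i) <= h i < f \<delta> for large i, hence \<rho> i <= \<delta>: eventually the covering
    intervals are admissible at scale \<delta>.\<close>
  have "eventually (\<lambda>i. h i < f \<delta>) sequentially"
    using order_tendstoD(2)[OF summable_LIMSEQ_zero[OF summ] fpos[OF \<delta>]] .
  then obtain i1 where i1: "\<And>i. i \<ge> i1 \<Longrightarrow> h i < f \<delta>" by (auto simp: eventually_sequentially)
  have pre: "hausdorff_pre f \<delta> (X i) \<le> ennreal (2 * real q * h i)" if "i \<ge> i1" for i
  proof (cases "i \<in> I_set a")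
    case True
    have "\<rho> i \<le> \<delta>"
    proof (rule ccontr)
      assume "\<not> \<rho> i \<le> \<delta>"
      then have "f \<delta> \<le> f (\<rho> i)" "0 < \<rho> i"
        using f \<delta> by (auto simp: dimension_function_def intro: mono_onD)
      moreover have "1 \<le> real q powr (real i * \<alpha>)" using q \<alpha> by (intro ge_one_powr_ge_zero) auto
      ultimately have "f \<delta> * 1 \<le> f (\<rho> i) * real q powr (real i * \<alpha>)"
        using fpos by (intro mult_mono) (auto simp: less_imp_le)
      then have "f \<delta> \<le> h i" using True \<open>0 < \<rho> i\<close> by (simp add: h_def powr_q)
      then show False using i1[OF that] by simp
    qed
    have dvd: "t ^ i dvd b ^ K i"
      using \<alpha> by (intro power_dvd_of_ge_alpha2 b t) (simp add: K_def \<alpha>_def[symmetric] real_nat_ceiling_ge)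
    have "hausdorff_pre f \<delta> (X i) \<le> (if \<rho> i > 0 then ennreal (2 * real (card D) ^ K i * f (\<rho> i)) else 0)"
    proof (rule hausdorff_pre_near_rationals_le[OF b(1,2) f m _ \<open>\<rho> i \<le> \<delta>\<close> \<delta>])
      show "\<rho> i = psiA a \<psi> i - real m / ((real b - 1) * real b ^ K i)" by (simp add: \<rho>_def K_def)
      fix x assume x: "x \<in> X i"
      then obtain p where p: "x \<in> cantor_set b D" "\<bar>x - real p / real t ^ i\<bar> < psiA a \<psi> i"
        using True by (auto simp: X_def)
      obtain r where r: "b ^ K i = t ^ i * r" using dvd by auto
      then have "real b ^ K i = real t ^ i * real r" by (metis of_nat_mult of_nat_power)
      moreover have "real r > 0" using r b(1) by (cases "r = 0") auto
      ultimately have "real p / real t ^ i = real (p * r) / real b ^ K i" by simp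
      then have "\<bar>x - real (p * r) / real b ^ K i\<bar> < psiA a \<psi> i" using p(2) by simp
      then show "x \<in> cantor_set b D \<and> (\<exists>p::nat. \<bar>x - real p / real b ^ K i\<bar> < psiA a \<psi> i)"
        using p(1) by blast
    qed
    also have "\<dots> \<le> ennreal (2 * real q * h i)"
    proof (cases "\<rho> i > 0")
      case pos: True
      \<comment> \<open>Rounding i \<alpha> up costs at most one factor q; together with the two
        intervals per word it gives the constant 2 q.\<close>
      have "real q ^ K i = real q powr real (K i)" using q by (simp add: powr_realpow)
      also have "\<dots> \<le> real q powr (1 + real i * \<alpha>)"
      proof (rule powr_mono)
        have "real (K i) = real_of_int \<lceil>real i * \<alpha>\<rceil>"
          using \<alpha> by (simp add: K_def of_nat_nat)
        then show "real (K i) \<le> 1 + real i * \<alpha>" by linarith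
      qed (use q in auto)
      also have "\<dots> = real q * real q powr (real i * \<alpha>)" using q by (simp add: powr_add)
      finally have "2 * real q ^ K i * f (\<rho> i) \<le> 2 * (real q * real q powr (real i * \<alpha>)) * f (\<rho> i)"
        using fpos[OF pos] by (intro mult_right_mono) auto
      also have "\<dots> = 2 * real q * h i" using True pos by (simp add: h_def powr_q)
      finally show ?thesis using pos by (simp add: q_def ennreal_leI)
    qed simp
    finally show ?thesis .
  next
    case False
    then show ?thesis using hausdorff_pre_empty[of \<delta> f] \<delta> by (simp add: X_def)
  qed
  have "hausdorff_pre f \<delta> (W_set t a \<psi> \<inter> cantor_set b D) \<le> 0 + ennreal e" if e: "e > 0" for e
  proof -
    obtain N where N: "\<And>n. n \<ge> N \<Longrightarrow> norm (\<Sum>i. h (i + n)) < e / (2 * real q)"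
      using suminf_exist_split[OF _ summ, of "e / (2 * real q)"] e q by auto
    define n where "n = max N i1"
    have sn: "summable (\<lambda>i. h (i + n))" using summ by (rule summable_ignore_initial_segment)
    have "W_set t a \<psi> \<inter> cantor_set b D \<subseteq> (\<Union>i. X (i + n))"
    proof
      fix x assume x: "x \<in> W_set t a \<psi> \<inter> cantor_set b D"
      then obtain i p where i: "i \<ge> n" "i \<in> I_set a" "\<bar>x - real p / real t ^ i\<bar> < psiA a \<psi> i"
        using W_set_iff[OF a t(1), of x \<psi>] by blast
      then have "x \<in> X ((i - n) + n)" using x by (auto simp: X_def)
      then show "x \<in> (\<Union>i. X (i + n))" by blast
    qed
    then have "hausdorff_pre f \<delta> (W_set t a \<psi> \<inter> cantor_set b D) \<le> hausdorff_pre f \<delta> (\<Union>i. X (i + n))"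
      by (rule hausdorff_pre_mono)
    also have "\<dots> \<le> (\<Sum>i. hausdorff_pre f \<delta> (X (i + n)))" by (rule hausdorff_pre_UN)
    also have "\<dots> \<le> (\<Sum>i. ennreal (2 * real q * h (i + n)))"
      by (intro suminf_le allI pre) (auto simp: n_def)
    also have "\<dots> = ennreal (\<Sum>i. 2 * real q * h (i + n))"
      using h0 by (intro suminf_ennreal2 summable_mult sn) simp
    also have "(\<Sum>i. 2 * real q * h (i + n)) = 2 * real q * (\<Sum>i. h (i + n))"
      by (rule suminf_mult[OF sn])
    also have "ennreal \<dots> \<le> ennreal e"
    proof (rule ennreal_leI)
      have "(\<Sum>i. h (i + n)) \<le> e / (2 * real q)" using N[of n] by (simp add: n_def)
      then show "2 * real q * (\<Sum>i. h (i + n)) \<le> e" using q by (simp add: pos_le_divide_eq mult.commute)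
    qed
    finally show ?thesis by simp
  qed
  then have "hausdorff_pre f \<delta> (W_set t a \<psi> \<inter> cantor_set b D) \<le> 0" by (rule ennreal_le_epsilon)
  then show "hausdorff_pre f \<delta> (W_set t a \<psi> \<inter> cantor_set b D) = 0" by simp
qed

section \<open>The divergence part\<close>

lemma summable_on_mod_classes:
  fixes g :: "nat \<Rightarrow> real"
  assumes "B > 0" "\<And>r. r < B \<Longrightarrow> g summable_on {i \<in> J. i mod B = r}"
  shows "g summable_on J"
proof -
  have "g summable_on {i \<in> J. i mod B < n}" if "n \<le> B" for n
    using that
  proof (induction n)
    case (Suc n)
    have "g summable_on ({i \<in> J. i mod B < n} \<union> {i \<in> J. i mod B = n})"
      using Suc assms(2)[of n] by (intro summable_on_Un_disjoint) auto
    moreover have "{i \<in> J. i mod B < n} \<union> {i \<in> J. i mod B = n} = {i \<in> J. i mod B < Suc n}" by auto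
    ultimately show ?case by simp
  qed simp
  from this[of B] show ?thesis using assms(1) by simp
qed

text \<open>With \<open>l0 i\<close> minimal such that b^-(k + l0 i) < \<rho> i, where k = floor (i
  \<alpha>), the term f (\<rho> i) q^(i \<alpha>) is comparable to G(k + l) q^-l for l near
  \<open>l0 i\<close>. Here G is a nondecreasing majorant of F. What remains is to pass from indices
  i to levels k, as several i may share a level when \<alpha> < 1.\<close>

lemma ex_divergent_levels:
  fixes \<rho> :: "nat \<Rightarrow> real" and q :: nat
  assumes b: "2 \<le> b" "2 \<le> q" and \<gamma>: "\<gamma> = ln (real q) / ln (real b)"
    and f: "dimension_function f"
    and G: "\<And>n. 0 < G n" "incseq G" "\<And>n. f (1 / real b ^ n) * real q ^ n \<le> G n"
    and \<alpha>: "0 < \<alpha>" and \<rho>: "\<And>i. i \<in> J \<Longrightarrow> 0 < \<rho> i"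
    and div: "\<not> summable (\<lambda>i. if i \<in> J then f (\<rho> i) * real b powr (real i * \<alpha> * \<gamma>) else 0)"
  shows "\<exists>S l. (\<forall>k\<in>S. 3 \<le> l k \<and> (\<exists>i\<in>J. nat \<lfloor>real i * \<alpha>\<rfloor> = k \<and> 1 / real b ^ (k + l k) < \<rho> i)) \<and>
    \<not> (\<lambda>k. G (k + l k) / real q ^ l k) summable_on S"
proof -
  define K where "K \<equiv> \<lambda>i::nat. nat \<lfloor>real i * \<alpha>\<rfloor>"
  define l0 where "l0 \<equiv> \<lambda>i. LEAST l. 1 / real b ^ (K i + l) < \<rho> i"
  \<comment> \<open>The shift by 3 provides the minimal block length that the choice of levels for
    the descent requires.\<close>
  define L where "L \<equiv> \<lambda>i. l0 i + 3"
  define g where "g \<equiv> \<lambda>i. G (K i + L i) / real q ^ L i"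
  have qpos: "0 < real q" using b by simp
  have g0: "0 < g i" for i using G(1) qpos by (simp add: g_def)
  have fpos: "0 < f r" if "r > 0" for r using f that by (simp add: dimension_function_def)
  have fmono: "mono_on {0<..} f" using f by (simp add: dimension_function_def)
  have powr_q: "real b powr (x * \<gamma>) = real q powr x" for x
    using powr_log_ratio(3)[OF b(1) _ \<gamma>] b(2) by simp
  have l0: "1 / real b ^ (K i + l0 i) < \<rho> i" if "i \<in> J" for i
  proof -
    have "0 < \<rho> i" by (rule \<rho>[OF that])
    then obtain n where "(1 / real b) ^ n < \<rho> i"
      using real_arch_pow_inv[of "\<rho> i" "1 / real b"] b by auto
    moreover have "1 / real b ^ (K i + n) \<le> 1 / real b ^ n"
      using b by (intro divide_left_mono power_increasing) auto
    ultimately have "1 / real b ^ (K i + n) < \<rho> i" by (simp add: power_divide)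
    then show ?thesis unfolding l0_def by (rule LeastI)
  qed
  have "\<not> g summable_on J"
  proof
    assume "g summable_on J"
    define h where "h \<equiv> \<lambda>i. if i \<in> J then g i else 0"
    have "h summable_on UNIV \<longleftrightarrow> g summable_on J"
      by (rule summable_on_cong_neutral) (auto simp: h_def)
    then have h: "summable h"
      using \<open>g summable_on J\<close> g0 by (subst (asm) summable_on_UNIV_nonneg_real_iff) (auto simp: h_def less_imp_le)
    \<comment> \<open>If \<open>l0 i\<close> were 0, then \<open>L i\<close> would be 3 and
      \<open>g i\<close> at least G(0) / q^3. So \<open>l0 i\<close> is positive for large i, and
      its minimality yields an upper bound on \<rho> i.\<close>
    have "0 < G 0 / real q ^ 3" using G(1) qpos by simp
    then have "eventually (\<lambda>i. h i < G 0 / real q ^ 3) sequentially"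
      using order_tendstoD(2)[OF summable_LIMSEQ_zero[OF h]] by blast
    then obtain i1 where i1: "\<And>i. i \<ge> i1 \<Longrightarrow> h i < G 0 / real q ^ 3"
      by (auto simp: eventually_sequentially)
    have "summable (\<lambda>i. if i \<in> J then f (\<rho> i) * real b powr (real i * \<alpha> * \<gamma>) else 0)"
    proof (rule summable_comparison_test')
      \<comment> \<open>Of the five factors q, three undo the shift in \<open>L\<close>, one comes
        from stepping back to \<open>l0 i - 1\<close>, and one from i \<alpha> <= K i + 1.\<close>
      show "summable (\<lambda>i. real q ^ 5 * h i)" using h by (rule summable_mult)
      fix i assume i: "i \<ge> i1"
      show "norm (if i \<in> J then f (\<rho> i) * real b powr (real i * \<alpha> * \<gamma>) else 0) \<le> real q ^ 5 * h i"
      proof (cases "i \<in> J")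
        case True
        have "l0 i \<noteq> 0"
        proof
          assume "l0 i = 0"
          then have "G 0 / real q ^ 3 \<le> h i"
            using True incseqD[OF G(2), of 0 "K i + 3"] qpos
            by (simp add: h_def g_def L_def divide_right_mono)
          then show False using i1[OF i] by simp
        qed
        then obtain j where j: "l0 i = Suc j" by (cases "l0 i") auto
        have "\<rho> i \<le> 1 / real b ^ (K i + j)"
          using not_less_Least[of j "\<lambda>l. 1 / real b ^ (K i + l) < \<rho> i"] j by (simp add: l0_def)
        then have "f (\<rho> i) \<le> f (1 / real b ^ (K i + j))"
          using \<rho>[OF True] b by (intro mono_onD[OF fmono]) auto
        also have "\<dots> \<le> G (K i + j) / real q ^ (K i + j)"
          using G(3)[of "K i + j"] qpos by (simp add: pos_le_divide_eq)
        also have "\<dots> \<le> G (K i + L i) / real q ^ (K i + j)"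
          using incseqD[OF G(2), of "K i + j" "K i + L i"] j qpos
          by (intro divide_right_mono) (auto simp: L_def)
        finally have 1: "f (\<rho> i) \<le> G (K i + L i) / real q ^ (K i + j)" .
        have "real b powr (real i * \<alpha> * \<gamma>) = real q powr (real i * \<alpha>)" by (rule powr_q)
        also have "\<dots> \<le> real q powr (real (Suc (K i)))"
        proof (rule powr_mono)
          have "real (K i) = real_of_int \<lfloor>real i * \<alpha>\<rfloor>"
            using \<alpha> by (simp add: K_def of_nat_nat)
          then show "real i * \<alpha> \<le> real (Suc (K i))" by linarith
        qed (use b in auto)
        also have "\<dots> = real q ^ Suc (K i)" by (rule powr_realpow[OF qpos])
        finally have "f (\<rho> i) * real b powr (real i * \<alpha> * \<gamma>) \<le>
            G (K i + L i) / real q ^ (K i + j) * real q ^ Suc (K i)"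
          using 1 fpos[OF \<rho>[OF True]] by (intro mult_mono) (auto intro: less_imp_le order_trans)
        also have "\<dots> = real q ^ 5 * g i"
          using qpos j by (simp add: g_def L_def power_add field_simps eval_nat_numeral)
        finally show ?thesis using True fpos[OF \<rho>[OF True]] by (simp add: h_def)
      qed (simp add: h_def)
    qed
    then show False using div by contradiction
  qed
  moreover obtain B where B: "1 / \<alpha> < real B" using reals_Archimedean2 by blast
  moreover have B0: "0 < B" using B \<alpha> by (cases "B = 0") (auto simp: not_less)
  ultimately obtain r where r: "\<not> g summable_on {i \<in> J. i mod B = r}"
    using summable_on_mod_classes by blast
  \<comment> \<open>Since B * \<open>\<alpha>\<close> > 1, the level \<open>K i\<close> determines i within a residue class modulo B.\<close>
  define J' where "J' = {i \<in> J. i mod B = r}"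
  have inj: "inj_on K J'"
  proof -
    have "K i < K i'" if "i \<in> J'" "i' \<in> J'" "i < i'" for i i'
    proof -
      have "B dvd i' - i" using that by (metis (mono_tags) J'_def less_imp_le mem_Collect_eq mod_eq_dvd_iff_nat)
      then have "B \<le> i' - i" using that(3) by (intro dvd_imp_le) auto
      then have "i + B \<le> i'" using that(3) by linarith
      then have "(real i + real B) * \<alpha> \<le> real i' * \<alpha>" using \<alpha> by (intro mult_right_mono) auto
      moreover have "1 < real B * \<alpha>" using B \<alpha> by (simp add: field_simps)
      ultimately have "real i * \<alpha> + 1 \<le> real i' * \<alpha>" by (simp add: distrib_right)
      then have "\<lfloor>real i * \<alpha>\<rfloor> + 1 \<le> \<lfloor>real i' * \<alpha>\<rfloor>" by linarith
      moreover have "0 \<le> \<lfloor>real i * \<alpha>\<rfloor>" using \<alpha> by simp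
      ultimately show ?thesis unfolding K_def by linarith
    qed
    then show ?thesis by (intro linorder_inj_onI' less_imp_neq)
  qed
  define l where "l \<equiv> \<lambda>k. L (inv_into J' K k)"
  have lK: "l (K i) = L i" if "i \<in> J'" for i
    using inj that by (simp add: l_def)
  have "\<not> (\<lambda>k. G (k + l k) / real q ^ l k) summable_on (K ` J')"
  proof -
    have "(\<lambda>k. G (k + l k) / real q ^ l k) summable_on (K ` J') \<longleftrightarrow>
        ((\<lambda>k. G (k + l k) / real q ^ l k) \<circ> K) summable_on J'"
      by (rule summable_on_reindex[OF inj])
    also have "\<dots> \<longleftrightarrow> g summable_on J'"
      by (rule summable_on_cong) (simp add: g_def lK)
    finally show ?thesis using r by (simp add: J'_def)
  qed
  moreover have "3 \<le> l k \<and> (\<exists>i\<in>J. nat \<lfloor>real i * \<alpha>\<rfloor> = k \<and> 1 / real b ^ (k + l k) < \<rho> i)"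
    if k: "k \<in> K ` J'" for k
  proof -
    obtain i where i: "i \<in> J'" "k = K i" using k by auto
    then have iJ: "i \<in> J" by (simp add: J'_def)
    have "1 / real b ^ (K i + L i) \<le> 1 / real b ^ (K i + l0 i)"
      using b by (intro divide_left_mono power_increasing) (auto simp: L_def)
    then have "1 / real b ^ (K i + L i) < \<rho> i" using l0[OF iJ] by simp
    then show ?thesis using i iJ lK[OF i(1)] by (auto simp: K_def L_def)
  qed
  ultimately show ?thesis by blast
qed

text \<open>A block of digits c at level k = floor (i \<alpha>1) puts the point within the margin
  plus b^-(k + l k) of a fraction p / b^k, hence within \<open>psiA a \<psi> i\<close>; since b^k
  divides t^i, that fraction has denominator t^i as well.\<close>

lemma limit_set_subset:
  fixes \<psi> :: "nat \<Rightarrow> real"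
  assumes b: "b \<ge> 2" "D \<subseteq> {0..<b}"
    and m: "m \<le> b - 1" "c = m \<or> c = b - 1 - m"
    and t: "t \<ge> 2"
    and a: "\<forall>n\<ge>1. \<forall>n'\<ge>n. a n \<le> a n'" "\<forall>K::nat. \<exists>n\<ge>1. a n > K"
    and \<alpha>: "\<alpha> = alpha1 b t" "0 < \<alpha>"
    and S: "\<And>k. k \<in> S \<Longrightarrow> \<exists>i\<in>I_set a. nat \<lfloor>real i * \<alpha>\<rfloor> = k \<and>
      1 / real b ^ (k + l k) < psiA a \<psi> i - real m / ((real b - 1) * real b ^ k)"
    and \<omega>: "\<And>k. \<omega> k \<in> D" "\<And>N. \<exists>k\<in>S. N \<le> k \<and> (\<forall>i\<in>{k..<k + l k}. \<omega> i = c)"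
  shows "val b \<omega> \<in> W_set t a \<psi> \<inter> cantor_set b D"
proof -
  have lt: "\<And>i. \<omega> i < b" using \<omega>(1) b(2) by (force simp: subset_iff)
  have "\<exists>i\<ge>i0. i \<in> I_set a \<and> (\<exists>p::nat. \<bar>val b \<omega> - real p / real t ^ i\<bar> < psiA a \<psi> i)" for i0
  proof -
    \<comment> \<open>A level of at least i0 \<alpha> forces the index i behind it to be at least
      i0, because k <= i \<alpha>.\<close>
    obtain k where k: "k \<in> S" "nat \<lceil>real i0 * \<alpha>\<rceil> \<le> k" "\<And>i. i \<in> {k..<k + l k} \<Longrightarrow> \<omega> i = c"
      using \<omega>(2) by blast
    obtain i where i: "i \<in> I_set a" "nat \<lfloor>real i * \<alpha>\<rfloor> = k"
        "1 / real b ^ (k + l k) < psiA a \<psi> i - real m / ((real b - 1) * real b ^ k)"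
      using S[OF k(1)] by blast
    have ki: "real k \<le> real i * \<alpha>" using i(2) \<alpha>(2) by (simp flip: i(2) add: of_nat_nat)
    have "real i0 * \<alpha> \<le> real k" using k(2) by linarith
    then have "real i0 * \<alpha> \<le> real i * \<alpha>" using ki by simp
    then have ge: "i0 \<le> i" using \<alpha>(2) by simp
    obtain p :: nat where p: "\<bar>val b \<omega> - real p / real b ^ k\<bar>
        \<le> real m / ((real b - 1) * real b ^ k) + 1 / real b ^ (k + l k)"
      using near_endpoint[where \<omega> = \<omega>, OF b(1) lt m k(3)] by blast
    obtain r where r: "t ^ i = b ^ k * r"
      using power_dvd_of_le_alpha1[OF b(1) t] ki \<alpha>(1) by blast
    then have "real t ^ i = real b ^ k * real r" by (metis of_nat_mult of_nat_power)
    moreover have "real r > 0" using r t by (cases "r = 0") auto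
    ultimately have "real p / real b ^ k = real (p * r) / real t ^ i" by simp
    then have "\<bar>val b \<omega> - real (p * r) / real t ^ i\<bar> < psiA a \<psi> i" using p i(3) by simp
    then show ?thesis using i(1) ge by blast
  qed
  moreover have "val b \<omega> \<in> cantor_set b D" using cantor_set_eq[OF b] \<omega>(1) by blast
  moreover have "0 \<le> val b \<omega>" "val b \<omega> \<le> 1"
    using val_range[where \<omega> = \<omega>, OF b(1) lt] by auto
  ultimately show ?thesis using W_set_iff[OF a t] by blast
qed

lemma divergence_part:
  fixes \<psi> :: "nat \<Rightarrow> real"
  assumes b: "b \<ge> 2" "D \<subseteq> {0..<b}" "2 \<le> card D"
    and \<gamma>: "\<gamma> = ln (real (card D)) / ln (real b)"
    and m: "m \<le> b - 1" "m \<in> D \<or> b - 1 - m \<in> D"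
    and t: "t \<ge> 2" "prime_factors t = prime_factors b"
    and a: "\<forall>n\<ge>1. \<forall>n'\<ge>n. a n \<le> a n'" "\<forall>K::nat. \<exists>n\<ge>1. a n > K"
    and f: "dimension_function f"
    and f_mono: "mono_on {0<..} (\<lambda>r. r powr (-\<gamma>) * f r) \<or> antimono_on {0<..} (\<lambda>r. r powr (-\<gamma>) * f r)"
  defines "\<alpha> \<equiv> alpha1 b t"
  defines "\<rho> \<equiv> \<lambda>i. psiA a \<psi> i - real m / ((real b - 1) * real b ^ nat \<lfloor>real i * \<alpha>\<rfloor>)"
  assumes div: "\<not> summable (\<lambda>i. if i \<in> I_set a \<and> 0 < \<rho> i
      then f (\<rho> i) * real b powr (real i * \<alpha> * \<gamma>) else 0)"
  shows "hausdorff_measure f (W_set t a \<psi> \<inter> cantor_set b D) = hausdorff_measure f (cantor_set b D)"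
proof (rule antisym)
  let ?W = "W_set t a \<psi> \<inter> cantor_set b D"
  show "hausdorff_measure f ?W \<le> hausdorff_measure f (cantor_set b D)"
    by (intro hausdorff_measure_mono) auto
  define q where "q = card D"
  define F where "F \<equiv> \<lambda>n. f (1 / real b ^ n) * real q ^ n"
  define J where "J = {i \<in> I_set a. 0 < \<rho> i}"
  have q: "2 \<le> q" "0 < real q" using b(3) by (auto simp: q_def)
  have F0: "0 < F n" for n using f b q by (simp add: F_def dimension_function_def)
  have \<alpha>0: "0 < \<alpha>" unfolding \<alpha>_def by (rule alpha1_pos[OF b(1) t(2)])
  obtain c where c: "c \<in> D" "c = m \<or> c = b - 1 - m" using m(2) by blast
  \<comment> \<open>G is the constant C when F is bounded by C, and F itself when F increases; both
    are nondecreasing majorants of F.\<close>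
  have levels: "\<exists>S l. (\<forall>k\<in>S. 3 \<le> l k \<and> (\<exists>i\<in>J. nat \<lfloor>real i * \<alpha>\<rfloor> = k \<and> 1 / real b ^ (k + l k) < \<rho> i)) \<and>
      \<not> (\<lambda>k. G (k + l k) / real q ^ l k) summable_on S"
    if "\<And>n. 0 < G n" "incseq G" "\<And>n. F n \<le> G n" for G
    using div q(1) that
    by (intro ex_divergent_levels[OF b(1) q(1) \<gamma>[folded q_def] f _ _ _ \<alpha>0]) (auto simp: J_def F_def)
  have subset: "val b \<omega> \<in> ?W"
    if "\<forall>k\<in>S. 3 \<le> l k \<and> (\<exists>i\<in>J. nat \<lfloor>real i * \<alpha>\<rfloor> = k \<and> 1 / real b ^ (k + l k) < \<rho> i)"
      "\<And>k. \<omega> k \<in> D" "\<And>N. \<exists>k\<in>S. N \<le> k \<and> (\<forall>i\<in>{k..<k + l k}. \<omega> i = c)" for S l \<omega>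
    by (rule limit_set_subset[OF b(1,2) m(1) c(2) t(1) a _ \<alpha>0 _ that(2,3)])
      (use that(1) in \<open>force simp: J_def \<rho>_def \<alpha>_def\<close>)+
  consider C where "\<And>n. F n \<le> C" | "incseq F" "\<And>B. \<exists>n. B < F n"
    using growth_dichotomy[OF b(1) _ \<gamma> f_mono] b(3) unfolding F_def q_def by fastforce
  then show "hausdorff_measure f (cantor_set b D) \<le> hausdorff_measure f ?W"
  proof cases
    case 1
    have C0: "0 < C" using F0[of 0] 1[of 0] by simp
    obtain S l where S: "\<forall>k\<in>S. 3 \<le> l k \<and> (\<exists>i\<in>J. nat \<lfloor>real i * \<alpha>\<rfloor> = k \<and> 1 / real b ^ (k + l k) < \<rho> i)"
        "\<not> (\<lambda>k. C / real q ^ l k) summable_on S"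
      using levels[of "\<lambda>_. C"] C0 1 by auto
    have div': "\<not> (\<lambda>k. 1 / real (card D) ^ l k) summable_on S"
    proof
      assume "(\<lambda>k. 1 / real (card D) ^ l k) summable_on S"
      then have "(\<lambda>k. C * (1 / real (card D) ^ l k)) summable_on S"
        by (rule summable_on_cmult_right)
      then show False using S(2) by (simp add: q_def)
    qed
    have fC: "f (1 / real b ^ n) \<le> C / real (card D) ^ n" for n
      using 1[of n] q by (simp add: F_def q_def pos_le_divide_eq)
    define X where "X \<equiv> \<lambda>N. {\<omega>. (\<forall>k. \<omega> k \<in> D) \<and> (\<forall>k\<in>S. N \<le> k \<longrightarrow> \<not> (\<forall>i\<in>{k..<k + l k}. \<omega> i = c))}"
    have cover: "cantor_set b D \<subseteq> ?W \<union> (\<Union>N. val b ` X N)"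
    proof
      fix x assume "x \<in> cantor_set b D"
      then obtain \<omega> where \<omega>: "x = val b \<omega>" "\<And>k. \<omega> k \<in> D"
        using cantor_set_eq[OF b(1,2)] by auto
      show "x \<in> ?W \<union> (\<Union>N. val b ` X N)"
      proof (cases "\<exists>N. \<omega> \<in> X N")
        case True
        then show ?thesis using \<omega>(1) by blast
      next
        case False
        have "\<exists>k\<in>S. N \<le> k \<and> (\<forall>i\<in>{k..<k + l k}. \<omega> i = c)" for N
        proof (rule ccontr)
          assume "\<not> ?thesis"
          then have "\<omega> \<in> X N" unfolding X_def using \<omega>(2) by blast
          then show False using False by blast
        qed
        then have "val b \<omega> \<in> ?W" by (rule subset[OF S(1) \<omega>(2)])
        then show ?thesis using \<omega>(1) by blast
      qed
    qed
    \<comment> \<open>The exceptional sets are null for every \<delta>, so the comparison is made at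
      a fixed \<delta> and the supremum is taken last.\<close>
    have "hausdorff_pre f \<delta> (cantor_set b D) \<le> hausdorff_measure f ?W" if \<delta>: "\<delta> > 0" for \<delta>
    proof -
      have "hausdorff_pre f \<delta> (\<Union>N. val b ` X N) \<le> (\<Sum>N. hausdorff_pre f \<delta> (val b ` X N))"
        by (rule hausdorff_pre_UN)
      also have "\<dots> = (\<Sum>N::nat. 0)"
        using hausdorff_pre_avoid_null[OF b c(1) f fC div' \<delta>] by (simp add: X_def)
      finally have null: "hausdorff_pre f \<delta> (\<Union>N. val b ` X N) = 0" by simp
      have "hausdorff_pre f \<delta> (cantor_set b D) \<le> hausdorff_pre f \<delta> (?W \<union> (\<Union>N. val b ` X N))"
        by (rule hausdorff_pre_mono[OF cover])
      also have "\<dots> \<le> hausdorff_pre f \<delta> ?W + hausdorff_pre f \<delta> (\<Union>N. val b ` X N)"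
        using \<delta> by (intro hausdorff_pre_Un) simp
      also have "\<dots> = hausdorff_pre f \<delta> ?W" by (simp add: null)
      also have "\<dots> \<le> hausdorff_measure f ?W"
        unfolding hausdorff_measure_def using \<delta> by (intro SUP_upper) simp
      finally show ?thesis .
    qed
    then show ?thesis unfolding hausdorff_measure_def[of f "cantor_set b D"]
      by (intro SUP_least) simp
  next
    case 2
    obtain S l where S: "\<forall>k\<in>S. 3 \<le> l k \<and> (\<exists>i\<in>J. nat \<lfloor>real i * \<alpha>\<rfloor> = k \<and> 1 / real b ^ (k + l k) < \<rho> i)"
        "\<not> (\<lambda>k. F (k + l k) / real (card D) ^ l k) summable_on S"
      using levels[of F] F0 2 by (auto simp: q_def)
    define \<Lambda> where "\<Lambda> = {\<omega>. (\<forall>k. \<omega> k \<in> D) \<and> (\<forall>N. \<exists>k\<in>S. N \<le> k \<and> (\<forall>i\<in>{k..<k + l k}. \<omega> i = c))}"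
    have sub: "val b ` \<Lambda> \<subseteq> ?W"
    proof
      fix x assume "x \<in> val b ` \<Lambda>"
      then obtain \<omega> where \<omega>: "x = val b \<omega>" "\<And>k. \<omega> k \<in> D"
          "\<And>N. \<exists>k\<in>S. N \<le> k \<and> (\<forall>i\<in>{k..<k + l k}. \<omega> i = c)" by (auto simp: \<Lambda>_def)
      then show "x \<in> ?W" using subset[OF S(1) \<omega>(2,3)] by simp
    qed
    have ge: "ennreal (F n / (48 * real q)) \<le> hausdorff_measure f ?W" for n
    proof -
      have "ennreal (F n / (48 * real (card D))) \<le> hausdorff_pre f (1 / real b ^ n) (val b ` \<Lambda>)"
        unfolding \<Lambda>_def
        by (rule hausdorff_pre_limit_ge[OF b c(1) f _ 2 _ S(2)]) (use S(1) in \<open>auto simp: F_def q_def\<close>)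
      also have "\<dots> \<le> hausdorff_pre f (1 / real b ^ n) ?W" by (rule hausdorff_pre_mono[OF sub])
      also have "\<dots> \<le> hausdorff_measure f ?W"
        unfolding hausdorff_measure_def using b(1) by (intro SUP_upper) simp
      finally show ?thesis by (simp add: q_def)
    qed
    \<comment> \<open>The lower bound F(n) / (48 q) holds for every n, and F is unbounded.\<close>
    have "hausdorff_measure f ?W = top"
    proof (rule ccontr)
      assume "hausdorff_measure f ?W \<noteq> top"
      then obtain r where r: "hausdorff_measure f ?W = ennreal r" "0 \<le> r"
        by (cases "hausdorff_measure f ?W") auto
      obtain n where n: "48 * real q * r < F n" using 2(2) by blast
      have "F n / (48 * real q) \<le> r" using ge[of n] r by simp
      then show False using n q by (simp add: pos_divide_le_eq mult.commute)
    qed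
    then show ?thesis by simp
  qed
qed

theorem theorem1p6:
  fixes b t :: nat and D :: "nat set" and a :: "nat \<Rightarrow> nat"
    and f :: "real \<Rightarrow> real" and \<psi> :: "nat \<Rightarrow> real"
  defines "(\<gamma>::real) \<equiv> ln (real (card D)) / ln (real b)"
      and "(m::nat) \<equiv> m_of b D"
      and "(\<alpha>\<^sub>1::real) \<equiv> alpha1 b t"
      and "(\<alpha>\<^sub>2::real) \<equiv> alpha2 b t"
  assumes b: "b \<ge> 3"
      and D: "D \<subseteq> {0..<b}" "2 \<le> card D" "card D \<le> b - 1"
      and t: "t \<ge> 2" "prime_factors t = prime_factors b"
      and a_pos: "\<forall>n\<ge>1. a n \<ge> 1"
      and a_mono: "\<forall>n\<ge>1. \<forall>n'\<ge>n. a n \<le> a n'"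
      and a_unbdd: "\<forall>K. \<exists>n\<ge>1. a n > K"
      and f: "dimension_function f"
      and f_mono: "mono_on {0<..} (\<lambda>r. r powr (-\<gamma>) * f r) \<or>
                   antimono_on {0<..} (\<lambda>r. r powr (-\<gamma>) * f r)"
      and \<psi>: "\<forall>n\<ge>1. \<psi> n > 0"
  shows
    "(summable (\<lambda>i. if i \<in> I_set a \<and>
                        psiA a \<psi> i > real m / ((real b - 1) * real b ^ nat \<lceil>real i * \<alpha>\<^sub>2\<rceil>)
                     then f (psiA a \<psi> i - real m / ((real b - 1) * real b ^ nat \<lceil>real i * \<alpha>\<^sub>2\<rceil>))
                            * real b powr (real i * \<alpha>\<^sub>2 * \<gamma>)
                     else 0)
       \<longrightarrow> hausdorff_measure f (W_set t a \<psi> \<inter> cantor_set b D) = 0)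
   \<and>
    (\<not> summable (\<lambda>i. if i \<in> I_set a \<and>
                        psiA a \<psi> i > real m / ((real b - 1) * real b ^ nat \<lfloor>real i * \<alpha>\<^sub>1\<rfloor>)
                     then f (psiA a \<psi> i - real m / ((real b - 1) * real b ^ nat \<lfloor>real i * \<alpha>\<^sub>1\<rfloor>))
                            * real b powr (real i * \<alpha>\<^sub>1 * \<gamma>)
                     else 0)
       \<longrightarrow> hausdorff_measure f (W_set t a \<psi> \<inter> cantor_set b D)
           = hausdorff_measure f (cantor_set b D))"
proof -
  have "D \<noteq> {}" using D(2) by auto
  note m = m_of_props[OF D(1) this, folded m_def]
  have b2: "2 \<le> b" using b by simp
  show ?thesis
    using convergence_part[OF b2 D(1,2) \<gamma>_def[THEN meta_eq_to_obj_eq] m(1,3) t a_mono a_unbdd f, of \<psi>]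
      divergence_part[OF b2 D(1,2) \<gamma>_def[THEN meta_eq_to_obj_eq] m(3,2) t a_mono a_unbdd f f_mono, of \<psi>]
    unfolding \<alpha>\<^sub>1_def \<alpha>\<^sub>2_def by simp
qed

end
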